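(* Let $R$ be a ring. Then $R$ is strongly 2-nil-clean if and only if the following three conditions all hold: (1) $R$ is feebly clean; (2) the Jacobson radical $J(R)$ is nil; (3) the unit group $U(R/J(R))$ has exponent $\leq 2$.
   Context: All rings are associative with identity (not necessarily commutative). $J(R)$ denotes the Jacobson radical and $U(R)$ the group of units of $R$. A ring $R$ is strongly 2-nil-clean if every element $a\in R$ can be written as $a=e+f+w$ with $e,f\in R$ idempotents and $w\in R$ nilpotent, where $e,f,w$ commute with one another. Two idempotents $e,f$ are orthogonal if $ef=fe=0$. A ring $R$ is feebly clean if every $a\in R$ can be written as $a=e-f+u$ with $e,f\in R$ orthogonal idempotents and $u\in U(R)$. "$U(R/J(R))$ has exponent $\leq 2$" means $v^2=1$ for all $v\in U(R/J(R))$. *)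

theory Defs
  imports "HOL-Algebra.Algebra"
begin

definition ring_idempotent :: "('a, 'b) ring_scheme \<Rightarrow> 'a \<Rightarrow> bool" where
  "ring_idempotent R e \<longleftrightarrow> e \<in> carrier R \<and> e \<otimes>\<^bsub>R\<^esub> e = e"

definition ring_nilpotent :: "('a, 'b) ring_scheme \<Rightarrow> 'a \<Rightarrow> bool" where
  "ring_nilpotent R w \<longleftrightarrow> w \<in> carrier R \<and> (\<exists>n::nat. n > 0 \<and> w [^]\<^bsub>R\<^esub> n = \<zero>\<^bsub>R\<^esub>)"

definition ring_commute :: "('a, 'b) ring_scheme \<Rightarrow> 'a \<Rightarrow> 'a \<Rightarrow> bool" where
  "ring_commute R x y \<longleftrightarrow> x \<otimes>\<^bsub>R\<^esub> y = y \<otimes>\<^bsub>R\<^esub> x"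

definition strongly_2_nil_clean :: "('a, 'b) ring_scheme \<Rightarrow> bool" where
  "strongly_2_nil_clean R \<longleftrightarrow>
     (\<forall>a \<in> carrier R. \<exists>e f w.
        ring_idempotent R e \<and> ring_idempotent R f \<and> ring_nilpotent R w \<and>
        ring_commute R e f \<and> ring_commute R e w \<and> ring_commute R f w \<and>
        a = e \<oplus>\<^bsub>R\<^esub> f \<oplus>\<^bsub>R\<^esub> w)"

definition orthogonal_idempotents :: "('a, 'b) ring_scheme \<Rightarrow> 'a \<Rightarrow> 'a \<Rightarrow> bool" where
  "orthogonal_idempotents R e f \<longleftrightarrow>
     ring_idempotent R e \<and> ring_idempotent R f \<and>
     e \<otimes>\<^bsub>R\<^esub> f = \<zero>\<^bsub>R\<^esub> \<and> f \<otimes>\<^bsub>R\<^esub> e = \<zero>\<^bsub>R\<^esub>"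

definition feebly_clean :: "('a, 'b) ring_scheme \<Rightarrow> bool" where
  "feebly_clean R \<longleftrightarrow>
     (\<forall>a \<in> carrier R. \<exists>e f. \<exists>u \<in> Units R.
        orthogonal_idempotents R e f \<and> a = (e \<ominus>\<^bsub>R\<^esub> f) \<oplus>\<^bsub>R\<^esub> u)"

text \<open>
  The library's \<^const>\<open>ideal\<close> and \<^const>\<open>maximalideal\<close> are two-sided.
  The Jacobson radical of a noncommutative ring needs maximal left ideals.
\<close>

definition left_ideal :: "('a, 'b) ring_scheme \<Rightarrow> 'a set \<Rightarrow> bool" where
  "left_ideal R I \<longleftrightarrow>
     additive_subgroup I R \<and> (\<forall>r \<in> carrier R. \<forall>x \<in> I. r \<otimes>\<^bsub>R\<^esub> x \<in> I)"

definition maximal_left_ideal :: "('a, 'b) ring_scheme \<Rightarrow> 'a set \<Rightarrow> bool" where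
  "maximal_left_ideal R M \<longleftrightarrow>
     left_ideal R M \<and> M \<noteq> carrier R \<and>
     (\<forall>I. left_ideal R I \<and> M \<subseteq> I \<longrightarrow> I = M \<or> I = carrier R)"

text \<open>
  The intersection with the carrier only matters for the zero ring, which has no
  maximal left ideals and is its own Jacobson radical.
\<close>

definition jacobson_radical :: "('a, 'b) ring_scheme \<Rightarrow> 'a set" where
  "jacobson_radical R = carrier R \<inter> \<Inter> {M. maximal_left_ideal R M}"

definition nil_subset :: "('a, 'b) ring_scheme \<Rightarrow> 'a set \<Rightarrow> bool" where
  "nil_subset R I \<longleftrightarrow> (\<forall>x \<in> I. ring_nilpotent R x)"

definition units_exponent_le_2 :: "('a, 'b) ring_scheme \<Rightarrow> bool" where
  "units_exponent_le_2 R \<longleftrightarrow> (\<forall>v \<in> Units R. v [^]\<^bsub>R\<^esub> (2::nat) = \<one>\<^bsub>R\<^esub>)"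

end

theory Submission
  imports Defs "HOL-Decision_Procs.Algebra_Aux" "HOL-Computational_Algebra.Polynomial"
begin

text \<open>
  Both sides are equivalent to one elementwise condition, \<open>cubic_nil\<close>: \<open>a\<^sup>3 - a\<close> is nilpotent for every
  \<open>a\<close>. If \<open>a = e + f + w\<close> with commuting idempotents and a nilpotent \<open>w\<close>, then \<open>a\<^sup>3 - a\<close> is
  \<open>6 e f\<close> modulo nilpotents, and decomposing \<open>a = 3\<close> shows that \<open>6\<close> is nilpotent. Conversely, if
  all \<open>a\<^sup>3 - a\<close> are nilpotent, then so is \<open>6 = 2\<^sup>3 - 2\<close>; modulo nilpotents the elements \<open>a\<^sup>2\<close> and
  \<open>a - a\<^sup>2\<close>, whose sum is \<open>a\<close>, are idempotent, and so is \<open>1 - a\<^sup>2\<close>, which differs from \<open>a\<close> by a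
  unit. Lifting these to idempotents that are polynomials in \<open>a\<close> gives strong 2-nil-cleanness and
  (feeble) cleanness.

  The Jacobson radical \<open>J\<close> enters through \<open>Q = R/J\<close>, which is semiprimitive. The key point is that
  \<open>Q\<close> is reduced under either set of hypotheses. If \<open>w\<^sup>2 = 0\<close> and \<open>w \<noteq> 0\<close>, then some \<open>1 - r w\<close> is
  not a unit, and cleanness of \<open>r w\<close> puts a nonzero idempotent into the left ideal generated by
  \<open>w\<close>. Together with \<open>w\<^sup>2 = 0\<close> such an idempotent generates a system of \<open>2 \<times> 2\<close> matrix units, hence
  a copy of the Fibonacci matrix \<open>((1,1),(1,0))\<close>, an \<open>a\<close> with \<open>a\<^sup>2 = a + g\<close> for a nonzero
  idempotent \<open>g\<close> that acts as identity on \<open>a\<close> (\<open>fibonacci_pair\<close>). It is invertible in the corner of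
  \<open>g\<close>, while \<open>a\<^sup>3 - a = a\<^sup>2\<close>; so \<open>a\<^sup>3 - a\<close> is not nilpotent, and \<open>a + (1 - g)\<close> is a unit whose
  square is not \<open>1\<close>.

  In the forward direction, \<open>Q\<close> reduced turns "\<open>v\<^sup>3 - v\<close> nilpotent" into \<open>v\<^sup>3 = v\<close>, so units of \<open>Q\<close>
  square to \<open>1\<close>; and \<open>J\<close> is nil because \<open>1 - a\<^sup>2\<close> is a unit for \<open>a\<close> in \<open>J\<close>. In the backward
  direction, idempotents of the reduced ring \<open>Q\<close> are central, so \<open>a = e - f + u\<close> is a decomposition
  into commuting elements; as \<open>u\<^sup>2 = 1\<close> and \<open>6 = 0\<close> in \<open>Q\<close>, the square of \<open>a\<^sup>3 - a\<close> vanishes.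
  Therefore \<open>a\<^sup>3 - a\<close> lies in the nil ideal \<open>J\<close> for every \<open>a\<close> in \<open>R\<close>.

  Most computations concern at most three commuting elements. They are carried out with integer
  polynomials and transported by evaluation (\<open>commutative_model\<close>, \<open>obtain_model3\<close>).
\<close>

section \<open>Commuting elements and integer polynomials\<close>

lemma power_diff_dvd:
  fixes x y :: "'c::comm_ring_1"
  shows "x - y dvd x ^ n - y ^ n"
proof (cases n)
  case (Suc m)
  then show ?thesis using diff_power_eq_sum[of x m y] by simp
qed simp

text \<open>
  The binomial expansion without its coefficients. It makes sums of commuting nilpotents nilpotent.
\<close>

lemma power_add_split:
  fixes p q :: "'c::comm_ring_1"
  shows "\<exists>s t. (p + q) ^ (m + n) = p ^ m * s + q ^ n * t"
proof (induction "m + n" arbitrary: m n)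
  case 0
  then show ?case by (intro exI[of _ 1] exI[of _ 0]) auto
next
  case (Suc k)
  show ?case
  proof (cases m)
    case 0
    then show ?thesis by (intro exI[of _ "(p + q) ^ n"] exI[of _ 0]) simp
  next
    case m: (Suc i)
    show ?thesis
    proof (cases n)
      case 0
      then show ?thesis by (intro exI[of _ 0] exI[of _ "(p + q) ^ m"]) simp
    next
      case n: (Suc j)
      obtain s t where st: "(p + q) ^ (i + n) = p ^ i * s + q ^ n * t"
        using Suc(1)[of i n] Suc(2) m by auto
      obtain s' t' where st': "(p + q) ^ (m + j) = p ^ m * s' + q ^ j * t'"
        using Suc(1)[of m j] Suc(2) n by auto
      have "(p + q) ^ (m + n) = p * (p + q) ^ (i + n) + q * (p + q) ^ (m + j)"
        by (simp add: m n algebra_simps)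
      also have "\<dots> = p ^ m * (s + q * s') + q ^ n * (p * t + t')"
        unfolding st st' by (simp add: m n algebra_simps)
      finally show ?thesis by blast
    qed
  qed
qed

text \<open>
  A homomorphism from a commutative ring type into \<open>R\<close>. An identity between commuting elements of
  \<open>R\<close> becomes one in the type \<open>'t\<close>, where the simplifier decides it, and relations in \<open>R\<close> become
  membership in the kernel (\<open>model_null\<close>) or in the radical of the kernel (\<open>model_nil\<close>). Both are
  ideals, so a relation follows from others once it is written as a combination of them.
\<close>

locale commutative_model = ring R
  for R :: "('a, 'b) ring_scheme" (structure) and \<phi> :: "'t::comm_ring_1 \<Rightarrow> 'a" +
  assumes model_closed [simp, intro]: "\<phi> p \<in> carrier R"
    and model_add: "\<phi> (p + q) = \<phi> p \<oplus> \<phi> q"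
    and model_mult: "\<phi> (p * q) = \<phi> p \<otimes> \<phi> q"
    and model_one [simp]: "\<phi> 1 = \<one>"
begin

lemma model_zero [simp]: "\<phi> 0 = \<zero>"
  using model_add[of 0 0] by (metis add.r_cancel_one' model_closed add_0)

lemma model_uminus: "\<phi> (- p) = \<ominus> \<phi> p"
  using model_add[of "- p" p] by (simp add: minus_equality)

lemma model_diff: "\<phi> (p - q) = \<phi> p \<ominus> \<phi> q"
  using model_add[of p "- q"] by (simp add: model_uminus a_minus_def)

lemma model_power: "\<phi> (p ^ n) = \<phi> p [^] n"
  by (induction n) (simp_all add: power_Suc2 model_mult del: power_Suc)

lemma model_commute: "ring_commute R (\<phi> p) (\<phi> q)"
  unfolding ring_commute_def by (metis model_mult mult.commute)

definition model_null :: "'t \<Rightarrow> bool" where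
  "model_null p \<longleftrightarrow> \<phi> p = \<zero>"

text \<open>
  The exponent \<open>0\<close> is harmless: a null power makes all higher powers null.
\<close>

definition model_nil :: "'t \<Rightarrow> bool" where
  "model_nil p \<longleftrightarrow> (\<exists>n. model_null (p ^ n))"

lemma model_null_add: "model_null p \<Longrightarrow> model_null q \<Longrightarrow> model_null (p + q)"
  by (simp add: model_null_def model_add)

lemma model_null_mult1: "model_null p \<Longrightarrow> model_null (p * q)"
  by (simp add: model_null_def model_mult)

lemma model_null_mult2: "model_null q \<Longrightarrow> model_null (p * q)"
  by (simp add: model_null_def model_mult)

lemma model_null_diff: "model_null p \<Longrightarrow> model_null q \<Longrightarrow> model_null (p - q)"
  by (simp add: model_null_def model_diff)

lemma model_null_dvd: "model_null p \<Longrightarrow> p dvd q \<Longrightarrow> model_null q"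
  by (auto simp: dvd_def intro: model_null_mult1)

lemma model_null_diff_iff: "model_null (p - q) \<longleftrightarrow> \<phi> p = \<phi> q"
  by (simp add: model_null_def model_diff)

lemma model_nil_iff_nilpotent: "model_nil p \<longleftrightarrow> ring_nilpotent R (\<phi> p)"
proof
  assume "model_nil p"
  then obtain n where "model_null (p ^ n)" by (auto simp: model_nil_def)
  then have "model_null (p ^ Suc n)" by (rule model_null_dvd) simp
  then show "ring_nilpotent R (\<phi> p)"
    unfolding ring_nilpotent_def model_null_def model_power by blast
next
  assume "ring_nilpotent R (\<phi> p)"
  then show "model_nil p"
    by (auto simp: ring_nilpotent_def model_nil_def model_null_def model_power)
qed

lemma model_nil_null: "model_null p \<Longrightarrow> model_nil p"
  unfolding model_nil_def by (rule exI[of _ 1]) simp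

lemma model_nil_add:
  assumes "model_nil p" "model_nil q"
  shows "model_nil (p + q)"
proof -
  obtain m n where "model_null (p ^ m)" "model_null (q ^ n)"
    using assms by (auto simp: model_nil_def)
  moreover obtain s t where "(p + q) ^ (m + n) = p ^ m * s + q ^ n * t"
    using power_add_split by blast
  ultimately have "model_null ((p + q) ^ (m + n))"
    by (simp add: model_null_add model_null_mult1)
  then show ?thesis unfolding model_nil_def by blast
qed

lemma model_nil_mult1: "model_nil p \<Longrightarrow> model_nil (p * q)"
  unfolding model_nil_def power_mult_distrib by (meson model_null_mult1)

lemma model_nil_uminus: "model_nil p \<Longrightarrow> model_nil (- p)"
  using model_nil_mult1[of p "- 1"] by simp

lemma model_nil_diff: "model_nil p \<Longrightarrow> model_nil q \<Longrightarrow> model_nil (p - q)"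
  using model_nil_add[of p "- q"] by (simp add: model_nil_uminus)

lemma model_nil_dvd: "model_nil p \<Longrightarrow> p dvd q \<Longrightarrow> model_nil q"
  by (auto simp: dvd_def intro: model_nil_mult1)

lemma model_nil_power_cancel: "model_nil (p ^ n) \<Longrightarrow> model_nil p"
  unfolding model_nil_def by (metis power_mult)

lemma model_unit_if_mult_one:
  assumes "\<phi> (p * q) = \<one>"
  shows "\<phi> p \<in> Units R"
proof -
  have "\<phi> p \<otimes> \<phi> q = \<one>" "\<phi> q \<otimes> \<phi> p = \<one>"
    using assms by (metis model_mult mult.commute)+
  then show ?thesis unfolding Units_def using model_closed by blast
qed

lemma model_unit_if_square_one_mod_nil:
  assumes "model_nil (u ^ 2 - 1)"
  shows "\<phi> u \<in> Units R"
proof -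
  have "model_nil (1 - u ^ 2)"
    using model_nil_uminus[OF assms] by simp
  then obtain n where n: "model_null ((1 - u ^ 2) ^ n)"
    by (auto simp: model_nil_def)
  \<comment> \<open>\<open>u\<^sup>2\<close> divides \<open>1 - (1 - u\<^sup>2)\<^sup>n\<close>: this is the geometric series for the inverse of \<open>u\<^sup>2\<close>.\<close>
  have "1 - (1 - u ^ 2) dvd 1 ^ n - (1 - u ^ 2) ^ n"
    by (rule power_diff_dvd)
  then obtain v where v: "1 - (1 - u ^ 2) ^ n = u ^ 2 * v"
    by (auto simp: dvd_def)
  have "\<phi> (u * (u * v)) = \<phi> (1 - (1 - u ^ 2) ^ n)"
    unfolding v by (simp add: monoid_mult_class.power2_eq_square mult.assoc)
  also have "\<dots> = \<one>"
    using n by (simp add: model_diff model_null_def a_minus_def)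
  finally show ?thesis by (rule model_unit_if_mult_one)
qed

text \<open>
  Idempotents lift modulo the nil ideal of the kernel: with \<open>(x\<^sup>2 - x)\<^sup>m\<close> null, the polynomial
  \<open>e = 1 - (1 - x\<^sup>m)\<^sup>m\<close> is divisible by \<open>x\<^sup>m\<close> and its complement by \<open>(1 - x)\<^sup>m\<close>, while
  \<open>e \<equiv> x\<close> modulo \<open>x\<^sup>2 - x\<close>.
\<close>

lemma model_lift_idempotent:
  assumes "model_nil (x ^ 2 - x)"
  obtains e where "model_null (e ^ 2 - e)" "model_nil (e - x)"
proof -
  obtain n where "model_null ((x ^ 2 - x) ^ n)"
    using assms by (auto simp: model_nil_def)
  then have null: "model_null ((x ^ 2 - x) ^ Suc n)"
    by (rule model_null_dvd) simp
  have pow: "z ^ 2 - z dvd z ^ Suc k - z" for z :: 't and k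
  proof (induction k)
    case (Suc k)
    have "z ^ Suc (Suc k) - z = z * (z ^ Suc k - z) + (z ^ 2 - z)"
      by (simp add: algebra_simps monoid_mult_class.power2_eq_square)
    then show ?case using Suc by (metis dvd_add dvd_mult dvd_refl)
  qed simp
  define c where "c = x ^ Suc n"
  define e where "e = 1 - (1 - c) ^ Suc n"
  \<comment> \<open>\<open>e\<close> is a multiple of \<open>x\<^sup>n\<^sup>+\<^sup>1\<close> and \<open>1 - e\<close> one of \<open>(1 - x)\<^sup>n\<^sup>+\<^sup>1\<close>.\<close>
  have "c dvd e"
    using power_diff_dvd[of 1 "1 - c" "Suc n"] by (simp add: e_def)
  then have "x ^ Suc n dvd e" by (simp add: c_def)
  moreover have "1 - x dvd 1 - c"
    using power_diff_dvd[of 1 x "Suc n"] by (simp add: c_def)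
  then have "(1 - x) ^ Suc n dvd 1 - e"
    unfolding e_def by (simp only: diff_diff_eq2 add_diff_cancel_left' dvd_power_same)
  ultimately have "x ^ Suc n * (1 - x) ^ Suc n dvd e * (1 - e)"
    by (rule mult_dvd_mono)
  moreover have "x ^ Suc n * (1 - x) ^ Suc n = (-1) ^ Suc n * (x ^ 2 - x) ^ Suc n"
    unfolding power_mult_distrib[symmetric] by (simp add: algebra_simps monoid_mult_class.power2_eq_square)
  moreover have "e * (1 - e) = - (e ^ 2 - e)"
    by (simp add: algebra_simps monoid_mult_class.power2_eq_square)
  ultimately have "(x ^ 2 - x) ^ Suc n dvd e ^ 2 - e"
    by (metis dvd_minus_iff dvd_mult_right)
  with null have "model_null (e ^ 2 - e)" by (rule model_null_dvd)
  moreover have "x ^ 2 - x dvd e - x"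
  proof -
    have "x ^ 2 - x dvd c - x" using pow by (simp only: c_def)
    moreover have "c - x dvd (1 - x) ^ Suc n - (1 - c) ^ Suc n"
      using power_diff_dvd[of "1 - x" "1 - c" "Suc n"] by simp
    ultimately have "x ^ 2 - x dvd (1 - x) ^ Suc n - (1 - c) ^ Suc n"
      by (rule dvd_trans)
    moreover have "x ^ 2 - x dvd (1 - x) ^ Suc n - (1 - x)"
      using pow[of "1 - x" n] by (simp add: algebra_simps monoid_mult_class.power2_eq_square)
    ultimately have "x ^ 2 - x dvd ((1 - x) ^ Suc n - (1 - c) ^ Suc n) - ((1 - x) ^ Suc n - (1 - x))"
      by (rule dvd_diff)
    then show ?thesis by (simp only: e_def) (simp add: algebra_simps)
  qed
  with assms have "model_nil (e - x)" by (rule model_nil_dvd)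
  ultimately show thesis by (rule that)
qed

end

lemma (in ring) nat_scalar_commute:
  "x \<in> carrier R \<Longrightarrow> x \<otimes> \<guillemotleft>n\<guillemotright>\<^sub>\<nat> = \<guillemotleft>n\<guillemotright>\<^sub>\<nat> \<otimes> x"
  by (induction n) (simp_all add: l_distr r_distr)

lemma (in ring) int_scalar_commute:
  "x \<in> carrier R \<Longrightarrow> x \<otimes> \<guillemotleft>i\<guillemotright> = \<guillemotleft>i\<guillemotright> \<otimes> x"
  by (simp add: of_integer_def nat_scalar_commute l_minus r_minus)

lemma (in ring) int_scalar_model: "commutative_model R (\<lambda>i. \<guillemotleft>i\<guillemotright>)"
  by unfold_locales simp_all

text \<open>
  Horner evaluation at \<open>a\<close>, with the coefficients mapped by \<open>h\<close>; multiplicative once \<open>a\<close>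
  commutes with the image of \<open>h\<close>.
\<close>

definition eval_at ::
    "('a, 'b) ring_scheme \<Rightarrow> ('t::comm_ring_1 \<Rightarrow> 'a) \<Rightarrow> 'a \<Rightarrow> 't poly \<Rightarrow> 'a" where
  "eval_at R h a p = fold_coeffs (\<lambda>c v. h c \<oplus>\<^bsub>R\<^esub> a \<otimes>\<^bsub>R\<^esub> v) p \<zero>\<^bsub>R\<^esub>"

context commutative_model
begin

context
  fixes a
  assumes a [simp]: "a \<in> carrier R"
begin

abbreviation "ev \<equiv> eval_at R \<phi> a"

lemma eval_at_0 [simp]: "ev 0 = \<zero>"
  by (simp add: eval_at_def)

lemma eval_at_pCons [simp]: "ev (pCons c p) = \<phi> c \<oplus> a \<otimes> ev p"
  by (cases "p = 0 \<and> c = 0") (auto simp: eval_at_def)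

lemma eval_at_closed [simp]: "ev p \<in> carrier R"
  by (induction p) simp_all

lemma eval_at_add: "ev (p + q) = ev p \<oplus> ev q"
proof (induction p q rule: poly_induct2)
  case (pCons c p d q)
  then show ?case by (simp add: model_add r_distr add.m_ac)
qed simp

lemma eval_at_commute:
  assumes "b \<in> carrier R" "\<And>c. \<phi> c \<otimes> b = b \<otimes> \<phi> c" "a \<otimes> b = b \<otimes> a"
  shows "ev p \<otimes> b = b \<otimes> ev p"
proof (induction p)
  case (pCons c p)
  have "a \<otimes> ev p \<otimes> b = b \<otimes> (a \<otimes> ev p)"
    using assms pCons(2) by (metis a eval_at_closed m_assoc)
  then show ?case using assms by (simp add: l_distr r_distr)
qed (use assms in simp)

context
  assumes comm: "\<And>c. \<phi> c \<otimes> a = a \<otimes> \<phi> c"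
begin

lemma eval_at_smult: "ev (smult c q) = \<phi> c \<otimes> ev q"
proof (induction q)
  case (pCons d q)
  have "\<phi> c \<otimes> (a \<otimes> ev q) = a \<otimes> (\<phi> c \<otimes> ev q)"
    using comm by (metis a eval_at_closed m_assoc model_closed)
  then show ?case using pCons by (simp add: model_mult r_distr)
qed simp

lemma eval_at_mult: "ev (p * q) = ev p \<otimes> ev q"
proof (induction p)
  case (pCons c p)
  then show ?case by (simp add: eval_at_add eval_at_smult l_distr m_assoc)
qed simp

lemma eval_at_model: "commutative_model R ev"
  by unfold_locales (simp_all add: eval_at_add eval_at_mult one_pCons)

end
end
end

text \<open>
  Adjoining the commuting elements one at a time: each evaluation extends the previous homomorphism,
  and its image still commutes with whatever commutes with the elements adjoined so far.
\<close>

lemma (in ring) obtain_model3: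
  assumes [simp]: "x \<in> carrier R" "y \<in> carrier R" "z \<in> carrier R"
    and xy: "x \<otimes> y = y \<otimes> x" and xz: "x \<otimes> z = z \<otimes> x" and yz: "y \<otimes> z = z \<otimes> y"
  obtains \<phi> :: "int poly poly poly \<Rightarrow> 'a" and p q r
  where "commutative_model R \<phi>" "\<phi> p = x" "\<phi> q = y" "\<phi> r = z"
proof -
  define \<phi>0 where "\<phi>0 = (\<lambda>i. \<guillemotleft>i\<guillemotright>)"
  define \<phi>1 where "\<phi>1 = eval_at R \<phi>0 x"
  define \<phi>2 where "\<phi>2 = eval_at R \<phi>1 y"
  define \<phi>3 where "\<phi>3 = eval_at R \<phi>2 z"
  interpret m0: commutative_model R \<phi>0
    unfolding \<phi>0_def by (rule int_scalar_model)
  have c0: "\<phi>0 i \<otimes> b = b \<otimes> \<phi>0 i" if "b \<in> carrier R" for i b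
    using that by (simp add: \<phi>0_def int_scalar_commute)
  interpret m1: commutative_model R \<phi>1
    unfolding \<phi>1_def by (rule m0.eval_at_model) (simp_all add: c0)
  have c1: "\<phi>1 p \<otimes> b = b \<otimes> \<phi>1 p" if "b \<in> carrier R" "x \<otimes> b = b \<otimes> x" for p b
    unfolding \<phi>1_def by (rule m0.eval_at_commute) (simp_all add: c0 that)
  interpret m2: commutative_model R \<phi>2
    unfolding \<phi>2_def by (rule m1.eval_at_model) (simp_all add: c1 xy)
  have c2: "\<phi>2 p \<otimes> z = z \<otimes> \<phi>2 p" for p
    unfolding \<phi>2_def by (rule m1.eval_at_commute) (simp_all add: c1 xz yz)
  interpret m3: commutative_model R \<phi>3
    unfolding \<phi>3_def by (rule m2.eval_at_model) (simp_all add: c2)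
  have "\<phi>1 [:0, 1:] = x" unfolding \<phi>1_def by simp
  moreover have "\<phi>2 [:0, 1:] = y" unfolding \<phi>2_def by simp
  moreover have "\<phi>3 [:0, 1:] = z" unfolding \<phi>3_def by simp
  moreover have "\<phi>2 [:p:] = \<phi>1 p" for p unfolding \<phi>2_def by simp
  moreover have "\<phi>3 [:p:] = \<phi>2 p" for p unfolding \<phi>3_def by simp
  ultimately show thesis
    using that[OF m3.commutative_model_axioms, of "[:[:[:0, 1:]:]:]" "[:[:0, 1:]:]" "[:0, 1:]"]
    by simp
qed

lemma (in ring) obtain_model2:
  assumes "x \<in> carrier R" "y \<in> carrier R" "x \<otimes> y = y \<otimes> x"
  obtains \<phi> :: "int poly poly poly \<Rightarrow> 'a" and p q
  where "commutative_model R \<phi>" "\<phi> p = x" "\<phi> q = y"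
  using obtain_model3[of x y y] assms by metis

lemma (in ring) obtain_model1:
  assumes "x \<in> carrier R"
  obtains \<phi> :: "int poly poly poly \<Rightarrow> 'a" and p
  where "commutative_model R \<phi>" "\<phi> p = x"
  using obtain_model3[of x x x] assms by metis

lemma (in commutative_model) model_of_int: "\<phi> (of_int i) = \<guillemotleft>i\<guillemotright>"
proof -
  have *: "\<phi> (of_nat n) = \<guillemotleft>n\<guillemotright>\<^sub>\<nat>" for n
    by (induction n) (simp_all add: model_add)
  show ?thesis
  proof (cases i)
    case (nonneg n)
    then show ?thesis using * by (simp add: of_integer_def)
  next
    case (neg n)
    have "\<phi> (of_int i) = \<ominus> \<phi> (of_nat (Suc n))"
      unfolding neg by (simp only: ring_1_class.of_int_minus ring_1_class.of_int_of_nat_eq model_uminus)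
    also have "\<dots> = \<guillemotleft>i\<guillemotright>"
      unfolding * neg by (simp add: of_integer_def nat_add_distrib)
    finally show ?thesis .
  qed
qed

section \<open>Rings in which every \<open>a\<^sup>3 - a\<close> is nilpotent\<close>

context commutative_model
begin

lemma idempotent_iff_null: "ring_idempotent R (\<phi> e) \<longleftrightarrow> model_null (e ^ 2 - e)"
  unfolding ring_idempotent_def model_null_diff_iff
  by (simp add: model_mult monoid_mult_class.power2_eq_square)

text \<open>
  Modulo nilpotents \<open>3 - e\<close> equals the idempotent \<open>f\<close>, and comparing it with its square gives
  \<open>6 = 4 e\<close>. Multiplied by the complementary idempotents \<open>e\<close> and \<open>1 - e\<close>, this gives \<open>2 e = 0\<close> and
  \<open>6 (1 - e) = 0\<close>.
\<close>

lemma six_nil_if_three_2_nil_clean: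
  assumes E: "model_nil (e ^ 2 - e)" and F: "model_nil (f ^ 2 - f)"
    and three: "model_nil (3 - e - f)"
  shows "model_nil 6"
proof -
  have "6 - 4 * e = (3 - e - f) * ((3 - e - f) + 2 * f - 1) + (f ^ 2 - f) - (e ^ 2 - e)"
    by (simp add: algebra_simps eval_nat_numeral)
  then have "model_nil (6 - 4 * e)"
    using assms by (simp only: model_nil_add model_nil_diff model_nil_mult1)
  moreover have "6 = (6 - 4 * e) * (1 + 2 * e) + (e ^ 2 - e) * 8"
    by (simp add: algebra_simps eval_nat_numeral)
  ultimately show ?thesis
    using E by (metis model_nil_add model_nil_mult1)
qed

text \<open>
  For commuting idempotents \<open>(e + f)\<^sup>3 - (e + f) = 6 e f\<close>; the general coefficients record by which
  multiples of \<open>e\<^sup>2 - e\<close>, \<open>f\<^sup>2 - f\<close> and \<open>w\<close> this is perturbed.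
\<close>

lemma cube_minus_self_nil_if_2_nil_clean:
  assumes "model_nil (e ^ 2 - e)" "model_nil (f ^ 2 - f)" "model_nil w" "model_nil 6"
  shows "model_nil ((e + f + w) ^ 3 - (e + f + w))"
proof -
  have "(e + f + w) ^ 3 - (e + f + w) =
      (e ^ 2 - e) * (e + 1 + 3 * f) + (f ^ 2 - f) * (f + 1 + 3 * e) +
      w * (w ^ 2 + 3 * (e + f) * w + 3 * (e + f) ^ 2 - 1) + 6 * (e * f)"
    by (simp add: algebra_simps eval_nat_numeral)
  then show ?thesis
    using assms by (auto intro!: model_nil_add model_nil_mult1)
qed

end

definition cubic_nil :: "('a, 'b) ring_scheme \<Rightarrow> bool" where
  "cubic_nil R \<longleftrightarrow> (\<forall>a \<in> carrier R. ring_nilpotent R (a [^]\<^bsub>R\<^esub> (3::nat) \<ominus>\<^bsub>R\<^esub> a))"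

lemma (in commutative_model) cubic_nil_model:
  "cubic_nil R \<Longrightarrow> model_nil (p ^ 3 - p)"
  by (simp add: model_nil_iff_nilpotent model_diff model_power cubic_nil_def)

lemma (in commutative_model) cubic_nil_six: "cubic_nil R \<Longrightarrow> model_nil 6"
  using cubic_nil_model[of 2] by simp

text \<open>
  The decomposition of the single element \<open>3\<close> comes first: it makes \<open>6\<close> nilpotent, which is then
  used for every other element.
\<close>

lemma (in ring) strongly_2_nil_clean_imp_cubic_nil:
  assumes clean: "strongly_2_nil_clean R"
  shows "cubic_nil R"
proof -
  have decompose: "\<exists>\<phi> p q r. commutative_model R (\<phi> :: int poly poly poly \<Rightarrow> 'a) \<and>
      \<phi> (p + q + r) = a \<and> commutative_model.model_nil R \<phi> (p ^ 2 - p) \<and>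
      commutative_model.model_nil R \<phi> (q ^ 2 - q) \<and> commutative_model.model_nil R \<phi> r"
    if a: "a \<in> carrier R" for a
  proof -
    obtain e f w where efw: "ring_idempotent R e" "ring_idempotent R f" "ring_nilpotent R w"
        "ring_commute R e f" "ring_commute R e w" "ring_commute R f w" "a = e \<oplus> f \<oplus> w"
      using clean a unfolding strongly_2_nil_clean_def by blast
    then obtain \<phi> :: "int poly poly poly \<Rightarrow> 'a" and p q r where
      \<phi>: "commutative_model R \<phi>" and pqr: "\<phi> p = e" "\<phi> q = f" "\<phi> r = w"
      using obtain_model3[of e f w]
      unfolding ring_idempotent_def ring_nilpotent_def ring_commute_def by metis
    interpret commutative_model R \<phi> by (rule \<phi>)
    have "\<phi> (p + q + r) = a" "model_nil r"
      using efw pqr by (simp_all add: model_add model_nil_iff_nilpotent)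
    moreover have "model_nil (p ^ 2 - p)" "model_nil (q ^ 2 - q)"
      using efw(1,2) unfolding pqr[symmetric] idempotent_iff_null
      by (simp_all add: model_nil_null)
    ultimately show ?thesis using \<phi> by blast
  qed
  obtain \<phi> :: "int poly poly poly \<Rightarrow> 'a" and p q r where
      \<phi>: "commutative_model R \<phi>" and sum: "\<phi> (p + q + r) = \<guillemotleft>3\<guillemotright>"
      and p: "commutative_model.model_nil R \<phi> (p ^ 2 - p)"
      and q: "commutative_model.model_nil R \<phi> (q ^ 2 - q)"
      and r: "commutative_model.model_nil R \<phi> r"
    using decompose[of "\<guillemotleft>3\<guillemotright>"] by auto
  interpret m: commutative_model R \<phi> by (rule \<phi>)
  have "m.model_null (3 - (p + q + r))"
    unfolding m.model_null_diff_iff using sum m.model_of_int[of 3] by simp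
  then have "m.model_nil ((3 - (p + q + r)) + r)"
    using r by (rule m.model_nil_add[OF m.model_nil_null])
  then have "m.model_nil (3 - p - q)" by (simp add: algebra_simps)
  with p q have "m.model_nil 6" by (rule m.six_nil_if_three_2_nil_clean)
  then have six: "ring_nilpotent R \<guillemotleft>6\<guillemotright>"
    using m.model_of_int[of 6] by (simp add: m.model_nil_iff_nilpotent)
  show ?thesis
    unfolding cubic_nil_def
  proof
    fix a assume "a \<in> carrier R"
    then obtain \<psi> :: "int poly poly poly \<Rightarrow> 'a" and p q r where
        \<psi>: "commutative_model R \<psi>" and sum: "\<psi> (p + q + r) = a"
        and nil: "commutative_model.model_nil R \<psi> (p ^ 2 - p)"
          "commutative_model.model_nil R \<psi> (q ^ 2 - q)" "commutative_model.model_nil R \<psi> r"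
      using decompose by blast
    interpret n: commutative_model R \<psi> by (rule \<psi>)
    have "n.model_nil 6"
      using six n.model_of_int[of 6] by (simp add: n.model_nil_iff_nilpotent)
    then show "ring_nilpotent R (a [^] (3::nat) \<ominus> a)"
      using n.cube_minus_self_nil_if_2_nil_clean[OF nil]
      by (simp add: n.model_nil_iff_nilpotent n.model_diff n.model_power sum)
  qed
qed

text \<open>
  The idempotent lifts \<open>1 - p\<^sup>2\<close>. Where \<open>p = 0\<close> it is \<open>1\<close> and leaves \<open>-1\<close>; where \<open>p = \<plusminus>1\<close> it is
  \<open>0\<close> and leaves \<open>p\<close>: the difference squares to \<open>1\<close> modulo nilpotents.
\<close>

lemma (in ring) cubic_nil_imp_clean:
  assumes cubic: "cubic_nil R" and a: "a \<in> carrier R"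
  shows "\<exists>e u. ring_idempotent R e \<and> u \<in> Units R \<and> a = e \<oplus> u"
proof -
  obtain \<phi> :: "int poly poly poly \<Rightarrow> 'a" and p where
      \<phi>: "commutative_model R \<phi>" and p: "\<phi> p = a"
    using obtain_model1[OF a] .
  interpret commutative_model R \<phi> by (rule \<phi>)
  have nil: "model_nil (p ^ 3 - p)" by (rule cubic_nil_model[OF cubic])
  have "(1 - p ^ 2) ^ 2 - (1 - p ^ 2) = (p ^ 3 - p) * p" by Groebner_Basis.algebra
  then have "model_nil ((1 - p ^ 2) ^ 2 - (1 - p ^ 2))"
    using nil by (simp add: model_nil_mult1)
  then obtain e where e: "model_null (e ^ 2 - e)" "model_nil (e - (1 - p ^ 2))"
    by (rule model_lift_idempotent)
  have "(p - e) ^ 2 - 1 = (p ^ 3 - p) * (p + 2) +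
      (e - (1 - p ^ 2)) * ((e - (1 - p ^ 2)) - 2 * (p - 1 + p ^ 2))"
    by Groebner_Basis.algebra
  then have "model_nil ((p - e) ^ 2 - 1)"
    using nil e(2) by (simp add: model_nil_add model_nil_mult1)
  then have "\<phi> (p - e) \<in> Units R" by (rule model_unit_if_square_one_mod_nil)
  moreover have "a = \<phi> e \<oplus> \<phi> (p - e)"
    by (simp add: model_add[symmetric] p)
  ultimately show ?thesis using e(1) idempotent_iff_null by blast
qed

lemma (in ring) cubic_nil_imp_feebly_clean:
  assumes "cubic_nil R"
  shows "feebly_clean R"
  unfolding feebly_clean_def
proof
  fix a assume "a \<in> carrier R"
  then obtain e u where "ring_idempotent R e" "u \<in> Units R" "a = e \<oplus> u"
    using cubic_nil_imp_clean[OF assms] by blast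
  then show "\<exists>e f. \<exists>u \<in> Units R. orthogonal_idempotents R e f \<and> a = (e \<ominus> f) \<oplus> u"
    by (intro exI[of _ e] exI[of _ \<zero>] bexI[of _ u])
      (simp_all add: orthogonal_idempotents_def ring_idempotent_def a_minus_def)
qed

text \<open>
  The identity \<open>p = p\<^sup>2 + (p - p\<^sup>2)\<close> splits \<open>p\<close> into idempotents modulo nilpotents. At the values
  \<open>0\<close> and \<open>1\<close> the second summand vanishes; at \<open>-1\<close> it is \<open>-2\<close>, which is \<open>1\<close> in characteristic
  \<open>3\<close> and nilpotent in characteristic \<open>2\<close>. Nilpotence of \<open>6\<close> covers both cases at once, through
  \<open>(3 (p\<^sup>2 - p))\<^sup>2 \<equiv> 18 (p\<^sup>2 - p)\<close>.
\<close>

lemma (in ring) cubic_nil_imp_strongly_2_nil_clean: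
  assumes cubic: "cubic_nil R"
  shows "strongly_2_nil_clean R"
  unfolding strongly_2_nil_clean_def
proof
  fix a assume "a \<in> carrier R"
  then obtain \<phi> :: "int poly poly poly \<Rightarrow> 'a" and p where
      \<phi>: "commutative_model R \<phi>" and p: "\<phi> p = a"
    using obtain_model1 by metis
  interpret commutative_model R \<phi> by (rule \<phi>)
  have nil: "model_nil (p ^ 3 - p)" by (rule cubic_nil_model[OF cubic])
  have six: "model_nil 6" by (rule cubic_nil_six[OF cubic])
  have "(p ^ 2) ^ 2 - p ^ 2 = (p ^ 3 - p) * p" by Groebner_Basis.algebra
  then have "model_nil ((p ^ 2) ^ 2 - p ^ 2)"
    using nil by (simp add: model_nil_mult1)
  then obtain e where e: "model_null (e ^ 2 - e)" "model_nil (e - p ^ 2)"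
    by (rule model_lift_idempotent)
  have "(3 * (p ^ 2 - p)) ^ 2 = (p ^ 3 - p) * (9 * p - 18) + 6 * (3 * (p ^ 2 - p))"
    by Groebner_Basis.algebra
  then have "model_nil ((3 * (p ^ 2 - p)) ^ 2)"
    using nil six by (simp only: model_nil_add model_nil_mult1)
  then have "model_nil (3 * (p ^ 2 - p))" by (rule model_nil_power_cancel)
  moreover have "(p - p ^ 2) ^ 2 - (p - p ^ 2) = (p ^ 3 - p) * (p - 2) + 3 * (p ^ 2 - p)"
    by Groebner_Basis.algebra
  ultimately have "model_nil ((p - p ^ 2) ^ 2 - (p - p ^ 2))"
    using nil by (simp only: model_nil_add model_nil_mult1)
  then obtain f where f: "model_null (f ^ 2 - f)" "model_nil (f - (p - p ^ 2))"
    by (rule model_lift_idempotent)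
  have "model_nil (- ((e - p ^ 2) + (f - (p - p ^ 2))))"
    using e(2) f(2) by (intro model_nil_uminus model_nil_add)
  then have "model_nil (p - e - f)" by (simp add: algebra_simps)
  moreover have "a = \<phi> e \<oplus> \<phi> f \<oplus> \<phi> (p - e - f)"
    by (simp add: model_add[symmetric] p)
  ultimately show "\<exists>e f w. ring_idempotent R e \<and> ring_idempotent R f \<and> ring_nilpotent R w \<and>
      ring_commute R e f \<and> ring_commute R e w \<and> ring_commute R f w \<and> a = e \<oplus> f \<oplus> w"
    using e(1) f(1) model_commute
    unfolding idempotent_iff_null[symmetric] model_nil_iff_nilpotent by blast
qed

section \<open>The Jacobson radical\<close>

text \<open>
  Closure under negatives comes from multiplication by \<open>-1\<close>.
\<close>

lemma left_ideal_iff: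
  assumes "ring R"
  shows "left_ideal R I \<longleftrightarrow> I \<subseteq> carrier R \<and> \<zero>\<^bsub>R\<^esub> \<in> I \<and>
    (\<forall>x \<in> I. \<forall>y \<in> I. x \<oplus>\<^bsub>R\<^esub> y \<in> I) \<and> (\<forall>r \<in> carrier R. \<forall>x \<in> I. r \<otimes>\<^bsub>R\<^esub> x \<in> I)"
    (is "_ \<longleftrightarrow> ?closed")
proof -
  interpret ring R by fact
  show ?thesis
  proof
    assume I: "left_ideal R I"
    then interpret additive_subgroup I R by (simp add: left_ideal_def)
    show ?closed
      using I a_subset by (auto simp: left_ideal_def)
  next
    assume I: ?closed
    have "\<ominus>\<^bsub>R\<^esub> x \<in> I" if "x \<in> I" for x
    proof -
      have "\<ominus>\<^bsub>R\<^esub> \<one>\<^bsub>R\<^esub> \<otimes>\<^bsub>R\<^esub> x \<in> I" using I that by blast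
      moreover have "x \<in> carrier R" using I that by blast
      ultimately show ?thesis by (simp add: l_minus)
    qed
    then have "subgroup I (add_monoid R)"
      using I by (intro add.subgroupI) (auto simp: a_inv_def)
    then show "left_ideal R I"
      using I by (simp add: left_ideal_def additive_subgroup_def)
  qed
qed

context ring
begin

lemma left_ideal_eq_carrier: "left_ideal R I \<Longrightarrow> \<one> \<in> I \<Longrightarrow> I = carrier R"
  using r_one by (fastforce simp: left_ideal_iff[OF ring_axioms])

lemma left_ideal_maximal_avoiding_one:
  assumes I: "left_ideal R I" and one: "\<one> \<notin> I"
  obtains M where "maximal_left_ideal R M" "I \<subseteq> M" "\<one> \<notin> M"
proof -
  define A where "A = {K. left_ideal R K \<and> I \<subseteq> K \<and> \<one> \<notin> K}"
  have "\<exists>M\<in>A. \<forall>K\<in>A. M \<subseteq> K \<longrightarrow> K = M"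
  proof (rule subset_Zorn_nonempty)
    show "A \<noteq> {}" using I one by (auto simp: A_def)
  next
    fix C assume "C \<noteq> {}" and chain: "subset.chain A C"
    have dir: "\<exists>K\<in>C. x \<in> K \<and> y \<in> K" if "x \<in> \<Union>C" "y \<in> \<Union>C" for x y
      using that chain unfolding subset_chain_def by blast
    have C: "left_ideal R K" "I \<subseteq> K" "\<one> \<notin> K" if "K \<in> C" for K
      using that chain by (auto simp: subset_chain_def A_def)
    have CI: "K \<subseteq> carrier R" "\<zero> \<in> K" "\<And>x y. x \<in> K \<Longrightarrow> y \<in> K \<Longrightarrow> x \<oplus> y \<in> K"
        "\<And>r x. r \<in> carrier R \<Longrightarrow> x \<in> K \<Longrightarrow> r \<otimes> x \<in> K" if "K \<in> C" for K
      using C(1)[OF that] unfolding left_ideal_iff[OF ring_axioms] by simp_all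
    have "left_ideal R (\<Union>C)"
      unfolding left_ideal_iff[OF ring_axioms]
    proof (intro conjI ballI)
      show "\<Union>C \<subseteq> carrier R" using CI(1) by blast
      show "\<zero> \<in> \<Union>C" using CI(2) \<open>C \<noteq> {}\<close> by blast
      show "x \<oplus> y \<in> \<Union>C" if "x \<in> \<Union>C" "y \<in> \<Union>C" for x y
        using dir[OF that] CI(3) by blast
      show "r \<otimes> x \<in> \<Union>C" if "r \<in> carrier R" "x \<in> \<Union>C" for r x
        using that CI(4) by blast
    qed
    moreover have "I \<subseteq> \<Union>C" "\<one> \<notin> \<Union>C" using C(2,3) \<open>C \<noteq> {}\<close> by blast+
    ultimately show "\<Union>C \<in> A" by (simp add: A_def)
  qed
  then obtain M where M: "M \<in> A" and max: "\<And>K. K \<in> A \<Longrightarrow> M \<subseteq> K \<Longrightarrow> K = M" by blast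
  have "maximal_left_ideal R M"
    unfolding maximal_left_ideal_def
  proof (intro conjI allI impI)
    show "left_ideal R M" "M \<noteq> carrier R" using M by (auto simp: A_def)
    fix K assume "left_ideal R K \<and> M \<subseteq> K"
    then show "K = M \<or> K = carrier R"
      using M max[of K] left_ideal_eq_carrier[of K] by (auto simp: A_def)
  qed
  then show thesis using that M by (auto simp: A_def)
qed

text \<open>
  Links the maximal left ideals with equations: if \<open>1 - r x\<close> had no left inverse, the left ideal it
  generates would lie in a maximal one, which also contains \<open>r x\<close> and hence \<open>1\<close>. Conversely, a
  maximal left ideal \<open>M\<close> without \<open>x\<close> satisfies \<open>M + R x = R\<close>, so some \<open>1 - r x\<close> lies in \<open>M\<close> and
  cannot be left invertible.
\<close>

lemma jacobson_radical_iff: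
  "x \<in> jacobson_radical R \<longleftrightarrow>
    x \<in> carrier R \<and> (\<forall>r \<in> carrier R. \<exists>s \<in> carrier R. s \<otimes> (\<one> \<ominus> r \<otimes> x) = \<one>)"
proof (intro iffI conjI ballI)
  assume x: "x \<in> jacobson_radical R"
  then show xR [simp]: "x \<in> carrier R" by (simp add: jacobson_radical_def)
  fix r assume r [simp]: "r \<in> carrier R"
  define y where "y = \<one> \<ominus> r \<otimes> x"
  have y [simp]: "y \<in> carrier R" by (simp add: y_def)
  show "\<exists>s \<in> carrier R. s \<otimes> (\<one> \<ominus> r \<otimes> x) = \<one>"
  proof (rule ccontr)
    assume no: "\<not> ?thesis"
    define I where "I = (\<lambda>s. s \<otimes> y) ` carrier R"
    have "left_ideal R I"
      unfolding left_ideal_iff[OF ring_axioms]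
    proof (intro conjI ballI)
      show "I \<subseteq> carrier R" by (auto simp: I_def)
      show "\<zero> \<in> I" unfolding I_def by (rule image_eqI[of _ _ \<zero>]) simp_all
    next
      fix a b assume "a \<in> I" "b \<in> I"
      then obtain s t where "s \<in> carrier R" "t \<in> carrier R" "a = s \<otimes> y" "b = t \<otimes> y"
        by (auto simp: I_def)
      then show "a \<oplus> b \<in> I"
        unfolding I_def by (intro image_eqI[of _ _ "s \<oplus> t"]) (simp_all add: l_distr)
    next
      fix a b assume "a \<in> carrier R" "b \<in> I"
      then obtain t where "t \<in> carrier R" "b = t \<otimes> y" by (auto simp: I_def)
      then show "a \<otimes> b \<in> I"
        using \<open>a \<in> carrier R\<close>
        unfolding I_def by (intro image_eqI[of _ _ "a \<otimes> t"]) (simp_all add: m_assoc)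
    qed
    moreover have "\<one> \<notin> I" using no by (auto simp: I_def y_def)
    ultimately obtain M where M: "maximal_left_ideal R M" "I \<subseteq> M" "\<one> \<notin> M"
      by (rule left_ideal_maximal_avoiding_one)
    then have M': "left_ideal R M" by (simp add: maximal_left_ideal_def)
    have "y \<in> I" unfolding I_def by (rule image_eqI[of _ _ \<one>]) simp_all
    then have "y \<in> M" using M by blast
    moreover have "x \<in> M" using x M(1) by (simp add: jacobson_radical_def)
    then have "r \<otimes> x \<in> M" using M' by (simp add: left_ideal_def)
    ultimately have "y \<oplus> r \<otimes> x \<in> M" using M' by (simp add: left_ideal_iff[OF ring_axioms])
    moreover have "y \<oplus> r \<otimes> x = \<one>"
      by (simp add: y_def a_minus_def a_assoc l_neg)
    ultimately show False using M(3) by simp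
  qed
next
  assume "x \<in> carrier R \<and> (\<forall>r \<in> carrier R. \<exists>s \<in> carrier R. s \<otimes> (\<one> \<ominus> r \<otimes> x) = \<one>)"
  then have x [simp]: "x \<in> carrier R"
    and inv: "\<And>r. r \<in> carrier R \<Longrightarrow> \<exists>s \<in> carrier R. s \<otimes> (\<one> \<ominus> r \<otimes> x) = \<one>" by auto
  have "x \<in> M" if max: "maximal_left_ideal R M" for M
  proof (rule ccontr)
    assume xM: "x \<notin> M"
    have M: "left_ideal R M" using max by (simp add: maximal_left_ideal_def)
    then have MR: "m \<in> carrier R" if "m \<in> M" for m
      using that by (auto simp: left_ideal_iff[OF ring_axioms])
    have M0: "\<zero> \<in> M" using M by (simp add: left_ideal_iff[OF ring_axioms])
    define K where "K = {m \<oplus> r \<otimes> x | m r. m \<in> M \<and> r \<in> carrier R}"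
    have "left_ideal R K"
      unfolding left_ideal_iff[OF ring_axioms]
    proof (intro conjI ballI)
      show "K \<subseteq> carrier R" using MR by (auto simp: K_def)
      show "\<zero> \<in> K" unfolding K_def using M0 by (intro CollectI exI[of _ \<zero>]) simp
    next
      fix a b assume "a \<in> K" "b \<in> K"
      then obtain m r n s where *: "m \<in> M" "n \<in> M" "r \<in> carrier R" "s \<in> carrier R"
        "a = m \<oplus> r \<otimes> x" "b = n \<oplus> s \<otimes> x" by (auto simp: K_def)
      then have "a \<oplus> b = (m \<oplus> n) \<oplus> (r \<oplus> s) \<otimes> x"
        using MR by (simp add: l_distr add.m_ac)
      moreover have "m \<oplus> n \<in> M" using M * by (simp add: left_ideal_iff[OF ring_axioms])
      ultimately show "a \<oplus> b \<in> K" using * unfolding K_def by blast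
    next
      fix c a assume c: "c \<in> carrier R" and "a \<in> K"
      then obtain m r where *: "m \<in> M" "r \<in> carrier R" "a = m \<oplus> r \<otimes> x"
        by (auto simp: K_def)
      then have "c \<otimes> a = c \<otimes> m \<oplus> (c \<otimes> r) \<otimes> x"
        using MR c by (simp add: r_distr m_assoc)
      moreover have "c \<otimes> m \<in> M" using M * c by (simp add: left_ideal_def)
      ultimately show "c \<otimes> a \<in> K" using * c unfolding K_def by blast
    qed
    moreover have "M \<subseteq> K"
    proof
      fix m assume "m \<in> M"
      then show "m \<in> K" unfolding K_def using MR
        by (intro CollectI exI[of _ m] exI[of _ \<zero>]) simp
    qed
    moreover have "x \<in> K"
      unfolding K_def using M0 by (intro CollectI exI[of _ \<zero>] exI[of _ \<one>]) simp
    ultimately have "K = carrier R"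
      using max xM unfolding maximal_left_ideal_def by blast
    then have "\<one> \<in> K" by simp
    then obtain m r where m: "m \<in> M" and r: "r \<in> carrier R" and eq: "\<one> = m \<oplus> r \<otimes> x"
      unfolding K_def by blast
    have "\<one> \<ominus> r \<otimes> x = m"
      unfolding eq using MR[OF m] r by (simp add: a_minus_def a_assoc r_neg)
    then obtain s where "s \<in> carrier R" "s \<otimes> m = \<one>" using inv[OF r] by auto
    then have "\<one> \<in> M" using M m unfolding left_ideal_def by force
    then show False
      using left_ideal_eq_carrier[OF M] max by (simp add: maximal_left_ideal_def)
  qed
  then show "x \<in> jacobson_radical R" by (simp add: jacobson_radical_def)
qed

lemma jacobson_radical_unit:
  assumes x: "x \<in> jacobson_radical R" and r [simp]: "r \<in> carrier R"
  shows "\<one> \<ominus> r \<otimes> x \<in> Units R"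
proof -
  have xR [simp]: "x \<in> carrier R" using x by (simp add: jacobson_radical_iff)
  obtain s where s [simp]: "s \<in> carrier R" and sx: "s \<otimes> (\<one> \<ominus> r \<otimes> x) = \<one>"
    using x r jacobson_radical_iff by blast
  \<comment> \<open>The left inverse has the same form \<open>1 - r' x\<close>, hence a left inverse of its own.\<close>
  have s_eq: "s = \<one> \<ominus> (\<ominus> (s \<otimes> r)) \<otimes> x"
  proof -
    have "s = (s \<ominus> s \<otimes> (r \<otimes> x)) \<oplus> s \<otimes> (r \<otimes> x)"
      by (simp add: a_minus_def a_assoc l_neg)
    also have "s \<ominus> s \<otimes> (r \<otimes> x) = s \<otimes> (\<one> \<ominus> r \<otimes> x)"
      by (simp add: a_minus_def r_distr r_minus)
    also have "\<dots> = \<one>" by (rule sx)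
    also have "\<one> \<oplus> s \<otimes> (r \<otimes> x) = \<one> \<ominus> (\<ominus> (s \<otimes> r)) \<otimes> x"
      by (simp add: a_minus_def l_minus m_assoc)
    finally show ?thesis .
  qed
  have "\<ominus> (s \<otimes> r) \<in> carrier R" by simp
  then obtain t where t [simp]: "t \<in> carrier R"
      and "t \<otimes> (\<one> \<ominus> (\<ominus> (s \<otimes> r)) \<otimes> x) = \<one>"
    using x jacobson_radical_iff by blast
  then have ts: "t \<otimes> s = \<one>" by (simp only: s_eq[symmetric])
  have "t = t \<otimes> (s \<otimes> (\<one> \<ominus> r \<otimes> x))" by (simp add: sx)
  also have "\<dots> = \<one> \<ominus> r \<otimes> x" by (simp add: m_assoc[symmetric] ts)
  finally have "t = \<one> \<ominus> r \<otimes> x" .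
  with ts sx show ?thesis unfolding Units_def by auto
qed

lemma jacobson_radical_ideal: "ideal (jacobson_radical R) R"
proof -
  have left: "left_ideal R (jacobson_radical R)"
    unfolding left_ideal_iff[OF ring_axioms]
  proof (intro conjI ballI)
    have M: "\<zero> \<in> M" "x \<in> M \<Longrightarrow> y \<in> M \<Longrightarrow> x \<oplus> y \<in> M"
        "r \<in> carrier R \<Longrightarrow> x \<in> M \<Longrightarrow> r \<otimes> x \<in> M"
      if "maximal_left_ideal R M" for M r x y
      using maximal_left_ideal_def[THEN iffD1, OF that, THEN conjunct1]
      unfolding left_ideal_iff[OF ring_axioms] by simp_all
    show "jacobson_radical R \<subseteq> carrier R" "\<zero> \<in> jacobson_radical R"
      using M(1) by (auto simp: jacobson_radical_def)
    show "x \<oplus> y \<in> jacobson_radical R" if "x \<in> jacobson_radical R" "y \<in> jacobson_radical R" for x y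
      using that M(2) by (auto simp: jacobson_radical_def)
    show "r \<otimes> x \<in> jacobson_radical R" if "r \<in> carrier R" "x \<in> jacobson_radical R" for r x
      using that M(3) by (auto simp: jacobson_radical_def)
  qed
  have right: "x \<otimes> y \<in> jacobson_radical R"
    if x: "x \<in> jacobson_radical R" and y [simp]: "y \<in> carrier R" for x y
  proof -
    have xR [simp]: "x \<in> carrier R" using x by (simp add: jacobson_radical_iff)
    have "\<exists>s \<in> carrier R. s \<otimes> (\<one> \<ominus> r \<otimes> (x \<otimes> y)) = \<one>" if r [simp]: "r \<in> carrier R" for r
    proof -
      obtain s where s [simp]: "s \<in> carrier R" and sx: "s \<otimes> (\<one> \<ominus> (y \<otimes> r) \<otimes> x) = \<one>"
        using x r jacobson_radical_iff by (metis m_closed y)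
      \<comment> \<open>A left inverse of \<open>1 - b a\<close> yields one of \<open>1 - a b\<close>, here with \<open>a = r x\<close>, \<open>b = y\<close>.\<close>
      have "(\<one> \<oplus> r \<otimes> x \<otimes> s \<otimes> y) \<otimes> (\<one> \<ominus> r \<otimes> (x \<otimes> y)) =
          \<one> \<ominus> r \<otimes> x \<otimes> y \<oplus> r \<otimes> x \<otimes> (s \<otimes> (\<one> \<ominus> (y \<otimes> r) \<otimes> x)) \<otimes> y"
        by (simp add: a_minus_def l_distr r_distr l_minus r_minus m_assoc minus_add a_ac)
      also have "\<dots> = \<one>"
        unfolding sx by (simp add: a_minus_def a_assoc l_neg)
      finally show ?thesis by (rule bexI) simp
    qed
    then show ?thesis by (simp add: jacobson_radical_iff)
  qed
  show ?thesis
  proof (rule idealI[OF ring_axioms])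
    show "subgroup (jacobson_radical R) (add_monoid R)"
      using left by (simp add: left_ideal_def additive_subgroup_def)
  qed (use left right in \<open>simp_all add: left_ideal_def\<close>)
qed

end

section \<open>Squares of zero in a semiprimitive ring\<close>

definition reduced_ring :: "('a, 'b) ring_scheme \<Rightarrow> bool" where
  "reduced_ring R \<longleftrightarrow> (\<forall>w \<in> carrier R. w \<otimes>\<^bsub>R\<^esub> w = \<zero>\<^bsub>R\<^esub> \<longrightarrow> w = \<zero>\<^bsub>R\<^esub>)"

lemma reduced_ringD:
  "reduced_ring R \<Longrightarrow> w \<in> carrier R \<Longrightarrow> w \<otimes>\<^bsub>R\<^esub> w = \<zero>\<^bsub>R\<^esub> \<Longrightarrow> w = \<zero>\<^bsub>R\<^esub>"
  by (simp add: reduced_ring_def)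

text \<open>
  The relations of the Fibonacci matrix \<open>a = ((1,1),(1,0))\<close> with the identity matrix as \<open>g\<close>.
\<close>

definition fibonacci_pair :: "('a, 'b) ring_scheme \<Rightarrow> 'a \<Rightarrow> 'a \<Rightarrow> bool" where
  "fibonacci_pair R a g \<longleftrightarrow> a \<in> carrier R \<and> ring_idempotent R g \<and> g \<noteq> \<zero>\<^bsub>R\<^esub> \<and>
     a \<otimes>\<^bsub>R\<^esub> g = a \<and> g \<otimes>\<^bsub>R\<^esub> a = a \<and> a \<otimes>\<^bsub>R\<^esub> a = a \<oplus>\<^bsub>R\<^esub> g"

context ring
begin

text \<open>
  The idempotent \<open>c = 1 - e - f\<close> annihilates \<open>e\<close> and \<open>f\<close> from the left, so \<open>c b = c u\<close>, and the
  conjugate \<open>u\<^sup>-\<^sup>1 c u = (u\<^sup>-\<^sup>1 c) b\<close> is an idempotent in \<open>R b\<close>.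
\<close>

lemma idempotent_in_left_ideal_of_feebly_clean:
  assumes ef: "orthogonal_idempotents R e f" and u: "u \<in> Units R"
    and b: "b = (e \<ominus> f) \<oplus> u" and ne: "e \<oplus> f \<noteq> \<one>"
  obtains s where "s \<in> carrier R" "ring_idempotent R (s \<otimes> b)" "s \<otimes> b \<noteq> \<zero>"
proof -
  have [simp]: "e \<in> carrier R" "f \<in> carrier R" "u \<in> carrier R" "inv u \<in> carrier R"
    and [simp]: "e \<otimes> e = e" "f \<otimes> f = f" "e \<otimes> f = \<zero>" "f \<otimes> e = \<zero>"
    using ef u by (auto simp: orthogonal_idempotents_def ring_idempotent_def)
  define c where "c = \<one> \<ominus> (e \<oplus> f)"
  have [simp]: "c \<in> carrier R" by (simp add: c_def)
  have ce: "c \<otimes> e = \<zero>" and cf: "c \<otimes> f = \<zero>"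
    by (simp_all add: c_def a_minus_def l_distr l_minus r_neg)
  have cc: "c \<otimes> c = c"
  proof -
    have "c \<otimes> c = c \<otimes> \<one> \<ominus> (c \<otimes> e \<oplus> c \<otimes> f)"
      by (subst (2) c_def) (simp add: a_minus_def r_distr r_minus)
    then show ?thesis by (simp add: ce cf a_minus_def)
  qed
  have c0: "c \<noteq> \<zero>"
  proof
    assume "c = \<zero>"
    then have "\<one> = e \<oplus> f"
      unfolding c_def by (simp add: r_right_minus_eq)
    with ne show False by simp
  qed
  have cb: "c \<otimes> b = c \<otimes> u"
    by (simp add: b r_distr a_minus_def r_minus ce cf)
  define s where "s = inv u \<otimes> c"
  have sb: "s \<otimes> b = inv u \<otimes> (c \<otimes> u)"
    by (simp add: s_def m_assoc cb[symmetric]) (simp add: b m_assoc)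
  have uinv: "u \<otimes> (inv u \<otimes> x) = x" if "x \<in> carrier R" for x
    using that u by (simp add: m_assoc[symmetric])
  have "s \<otimes> b \<otimes> (s \<otimes> b) = inv u \<otimes> (c \<otimes> c \<otimes> u)"
    by (simp add: sb m_assoc uinv)
  then have "ring_idempotent R (s \<otimes> b)"
    by (simp add: ring_idempotent_def cc sb)
  moreover have "s \<otimes> b \<noteq> \<zero>"
  proof
    assume "s \<otimes> b = \<zero>"
    then have "u \<otimes> (s \<otimes> b) \<otimes> inv u = \<zero>" by simp
    moreover have "u \<otimes> (s \<otimes> b) \<otimes> inv u = c"
      using u by (simp add: sb uinv m_assoc)
    ultimately show False using c0 by simp
  qed
  moreover have "s \<in> carrier R" by (simp add: s_def)
  ultimately show thesis using that by blast
qed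

text \<open>
  The relations make \<open>e\<close>, \<open>p\<close>, \<open>q\<close> and \<open>q p\<close> the matrix units \<open>e\<^sub>1\<^sub>1\<close>, \<open>e\<^sub>1\<^sub>2\<close>, \<open>e\<^sub>2\<^sub>1\<close> and
  \<open>e\<^sub>2\<^sub>2\<close>.
\<close>

lemma fibonacci_pair_of_matrix_units:
  assumes [simp]: "e \<in> carrier R" "p \<in> carrier R" "q \<in> carrier R"
    and rel: "e \<otimes> e = e" "e \<otimes> p = p" "p \<otimes> e = \<zero>" "e \<otimes> q = \<zero>" "q \<otimes> e = q" "p \<otimes> q = e"
    and e0: "e \<noteq> \<zero>"
  shows "fibonacci_pair R (e \<oplus> p \<oplus> q) (e \<oplus> q \<otimes> p)"
proof -
  have pp: "p \<otimes> p = \<zero>" using m_assoc[of p e p] by (simp add: rel)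
  have qq: "q \<otimes> q = \<zero>" using m_assoc[of q e q] by (simp add: rel)
  note rel2 = rel pp qq
  have rel3: "e \<otimes> (e \<otimes> x) = e \<otimes> x" "e \<otimes> (p \<otimes> x) = p \<otimes> x" "p \<otimes> (e \<otimes> x) = \<zero>"
      "e \<otimes> (q \<otimes> x) = \<zero>" "q \<otimes> (e \<otimes> x) = q \<otimes> x" "p \<otimes> (q \<otimes> x) = e \<otimes> x"
      "p \<otimes> (p \<otimes> x) = \<zero>" "q \<otimes> (q \<otimes> x) = \<zero>" if "x \<in> carrier R" for x
    using that by (simp_all add: m_assoc[symmetric] rel2)
  have "e \<otimes> (e \<oplus> q \<otimes> p) = e" by (simp add: r_distr rel2 rel3)
  then have "e \<oplus> q \<otimes> p \<noteq> \<zero>" using e0 by auto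
  then show ?thesis
    unfolding fibonacci_pair_def ring_idempotent_def
    by (simp add: l_distr r_distr m_assoc rel2 rel3 a_ac)
qed

text \<open>
  For \<open>e = s w\<close> the element \<open>w e\<close> takes the corner of \<open>e\<close> to that of \<open>w e s\<close>, with inverse \<open>e s\<close>.
  Since \<open>w\<^sup>2 = 0\<close> gives \<open>e (w e) = 0\<close>, the two corners become orthogonal once \<open>e s\<close> is replaced by
  \<open>e s (1 - e)\<close>.
\<close>

lemma fibonacci_pair_of_square_zero:
  assumes [simp]: "w \<in> carrier R" "s \<in> carrier R" and ww: "w \<otimes> w = \<zero>"
    and idem: "ring_idempotent R (s \<otimes> w)" and ne: "s \<otimes> w \<noteq> \<zero>"
  shows "\<exists>a g. fibonacci_pair R a g"
proof -
  define e where "e = s \<otimes> w"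
  define q where "q = w \<otimes> e"
  define p where "p = e \<otimes> s \<otimes> (\<one> \<ominus> e)"
  have [simp]: "e \<in> carrier R" "q \<in> carrier R" "p \<in> carrier R"
    by (simp_all add: e_def q_def p_def)
  have ee: "e \<otimes> e = e" using idem by (simp add: e_def ring_idempotent_def)
  have wwx: "w \<otimes> (w \<otimes> x) = \<zero>" if "x \<in> carrier R" for x
    using that by (simp add: m_assoc[symmetric] ww)
  have "s \<otimes> w \<otimes> q = \<zero>" by (simp add: q_def m_assoc wwx)
  then have eq: "e \<otimes> q = \<zero>" by (simp add: e_def)
  have qe: "q \<otimes> e = q" by (simp add: q_def m_assoc ee)
  have ep: "e \<otimes> p = p" by (simp add: p_def m_assoc[symmetric] ee)
  have pe: "p \<otimes> e = \<zero>"
    by (simp add: p_def m_assoc a_minus_def l_distr l_minus ee r_neg)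
  have "(\<one> \<ominus> e) \<otimes> q = q" by (simp add: a_minus_def l_distr l_minus eq)
  then have "p \<otimes> q = e \<otimes> (s \<otimes> w) \<otimes> e" by (simp add: p_def m_assoc) (simp add: q_def m_assoc)
  then have pq: "p \<otimes> q = e" by (simp add: e_def[symmetric] ee)
  have "e \<noteq> \<zero>" using ne by (simp add: e_def)
  with fibonacci_pair_of_matrix_units[of e p q] ee ep pe eq qe pq show ?thesis by auto
qed

lemma fibonacci_pair_not_cubic_nil:
  assumes fib: "fibonacci_pair R a g"
  shows "\<not> cubic_nil R"
proof
  assume cubic: "cubic_nil R"
  have [simp]: "a \<in> carrier R" "g \<in> carrier R"
    and rel: "g \<otimes> g = g" "a \<otimes> g = a" "g \<otimes> a = a" "a \<otimes> a = a \<oplus> g" and g0: "g \<noteq> \<zero>"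
    using fib by (auto simp: fibonacci_pair_def ring_idempotent_def)
  obtain \<phi> :: "int poly poly poly \<Rightarrow> 'a" and p q where
      \<phi>: "commutative_model R \<phi>" and p: "\<phi> p = a" and q: "\<phi> q = g"
    using obtain_model2[of a g] rel by auto
  interpret commutative_model R \<phi> by (rule \<phi>)
  have null: "model_null (p * q - p)" "model_null (q ^ 2 - q)" "model_null (p ^ 2 - p - q)"
    using p q rel
    by (simp_all add: model_null_diff_iff model_mult model_add monoid_mult_class.power2_eq_square
        diff_diff_eq)
  \<comment> \<open>As \<open>a\<^sup>3 - a = a\<^sup>2\<close>, the element \<open>a\<close> is nilpotent, and with it \<open>g = a (a - 1)\<close>.\<close>
  have "p ^ 2 = (p ^ 3 - p) - (p ^ 2 - p - q) * p - (p * q - p)"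
    by (simp add: algebra_simps eval_nat_numeral)
  moreover have "model_nil (p ^ 3 - p)" by (rule cubic_nil_model[OF cubic])
  ultimately have "model_nil (p ^ 2)"
    using null by (metis model_nil_add model_nil_diff model_nil_mult1 model_nil_null)
  then have "model_nil p" by (rule model_nil_power_cancel)
  then have "model_nil (p * (p - 1) - (p ^ 2 - p - q))"
    using null by (metis model_nil_diff model_nil_mult1 model_nil_null)
  then have "model_nil q"
    by (simp add: algebra_simps monoid_mult_class.power2_eq_square)
  then obtain n where "model_null (q ^ n)" by (auto simp: model_nil_def)
  then have "g [^] n = \<zero>" by (simp add: model_null_def model_power q)
  then have "g [^] Suc n = \<zero>" by simp
  moreover have "g [^] Suc m = g" for m
    by (induction m) (simp_all add: rel)
  ultimately show False using g0 by simp
qed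

text \<open>
  The unit is \<open>a + (1 - g)\<close>, with inverse \<open>(a - g) + (1 - g)\<close>; its square exceeds \<open>1\<close> by \<open>a\<close>.
\<close>

lemma fibonacci_pair_not_exponent_2:
  assumes fib: "fibonacci_pair R a g"
  shows "\<not> units_exponent_le_2 R"
proof
  assume exponent: "units_exponent_le_2 R"
  have [simp]: "a \<in> carrier R" "g \<in> carrier R"
    and rel: "g \<otimes> g = g" "a \<otimes> g = a" "g \<otimes> a = a" "a \<otimes> a = a \<oplus> g" and g0: "g \<noteq> \<zero>"
    using fib by (auto simp: fibonacci_pair_def ring_idempotent_def)
  obtain \<phi> :: "int poly poly poly \<Rightarrow> 'a" and p q where
      \<phi>: "commutative_model R \<phi>" and p: "\<phi> p = a" and q: "\<phi> q = g"
    using obtain_model2[of a g] rel by auto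
  interpret commutative_model R \<phi> by (rule \<phi>)
  have null: "model_null (p * q - p)" "model_null (q ^ 2 - q)" "model_null (p ^ 2 - p - q)"
    using p q rel
    by (simp_all add: model_null_diff_iff model_mult model_add monoid_mult_class.power2_eq_square
        diff_diff_eq)
  have "(p + 1 - q) * (p - q + 1 - q) - 1 =
      (p ^ 2 - p - q) - 3 * (p * q - p) + 2 * (q ^ 2 - q)"
    by (simp add: algebra_simps eval_nat_numeral)
  then have "model_null ((p + 1 - q) * (p - q + 1 - q) - 1)"
    using null by (simp only: model_null_add model_null_diff model_null_mult2)
  then have "\<phi> (p + 1 - q) \<in> Units R"
    by (intro model_unit_if_mult_one) (simp add: model_null_diff_iff)
  then have "\<phi> ((p + 1 - q) ^ 2) = \<phi> 1"
    using exponent by (simp add: units_exponent_le_2_def model_power)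
  then have "model_null ((p + 1 - q) ^ 2 - 1)" by (simp only: model_null_diff_iff)
  moreover have "p = ((p + 1 - q) ^ 2 - 1) - (p ^ 2 - p - q) + 2 * (p * q - p) - (q ^ 2 - q)"
    by (simp add: algebra_simps eval_nat_numeral)
  ultimately have "model_null p"
    using null by (metis model_null_add model_null_diff model_null_mult2)
  then have "a = \<zero>" by (simp add: model_null_def p)
  then show False using rel(4) g0 by simp
qed

text \<open>
  The common part of the two reducedness arguments. Both exclude Fibonacci pairs and find idempotents
  in left ideals, but for different reasons, hence the abstract hypotheses \<open>no_pair\<close> and \<open>idem\<close>.
\<close>

lemma semiprimitive_reduced:
  assumes semiprimitive: "jacobson_radical R \<subseteq> {\<zero>}"
    and no_pair: "\<And>a g. \<not> fibonacci_pair R a g"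
    and idem: "\<And>w r. w \<in> carrier R \<Longrightarrow> w \<otimes> w = \<zero> \<Longrightarrow> r \<in> carrier R \<Longrightarrow> \<one> \<ominus> r \<otimes> w \<notin> Units R \<Longrightarrow>
      \<exists>s \<in> carrier R. ring_idempotent R (s \<otimes> (r \<otimes> w)) \<and> s \<otimes> (r \<otimes> w) \<noteq> \<zero>"
  shows "reduced_ring R"
  unfolding reduced_ring_def
proof (intro ballI impI, rule ccontr)
  fix w assume w: "w \<in> carrier R" "w \<otimes> w = \<zero>" "w \<noteq> \<zero>"
  then have "w \<notin> jacobson_radical R" using semiprimitive by auto
  then obtain r where r: "r \<in> carrier R" "\<one> \<ominus> r \<otimes> w \<notin> Units R"
    using w(1) jacobson_radical_iff Units_l_inv_ex by blast
  then obtain s where s: "s \<in> carrier R" "ring_idempotent R (s \<otimes> (r \<otimes> w))" "s \<otimes> (r \<otimes> w) \<noteq> \<zero>"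
    using idem w by blast
  then have "\<exists>a g. fibonacci_pair R a g"
    using fibonacci_pair_of_square_zero[of w "s \<otimes> r"] w r by (simp add: m_assoc)
  then show False using no_pair by blast
qed

lemma reduced_nilpotent_zero:
  assumes reduced: "reduced_ring R" and x: "ring_nilpotent R x"
  shows "x = \<zero>"
proof -
  have xR [simp]: "x \<in> carrier R" using x by (simp add: ring_nilpotent_def)
  obtain n :: nat where n: "x [^] n = \<zero>" using x by (auto simp: ring_nilpotent_def)
  have "x [^] ((2::nat) ^ n) = x [^] n \<otimes> x [^] (2 ^ n - n)"
    by (simp add: nat_pow_mult)
  then have "x [^] ((2::nat) ^ n) = \<zero>" by (simp add: n)
  moreover have "x [^] ((2::nat) ^ k) = \<zero> \<Longrightarrow> x = \<zero>" for k
  proof (induction k)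
    case (Suc k)
    have "x [^] ((2::nat) ^ k) \<otimes> x [^] ((2::nat) ^ k) = \<zero>"
      using Suc(2) by (simp only: nat_pow_mult[OF xR] power_Suc mult_2)
    then have "x [^] ((2::nat) ^ k) = \<zero>"
      by (rule reduced_ringD[OF reduced, rotated]) simp
    then show ?case by (rule Suc.IH)
  qed simp
  ultimately show ?thesis by blast
qed

text \<open>
  The corners \<open>e r (1 - e)\<close> and \<open>(1 - e) r e\<close> square to zero, hence vanish.
\<close>

lemma reduced_idempotent_central:
  assumes reduced: "reduced_ring R" and e: "ring_idempotent R e" and r [simp]: "r \<in> carrier R"
  shows "e \<otimes> r = r \<otimes> e"
proof -
  have [simp]: "e \<in> carrier R" and ee: "e \<otimes> e = e" using e by (auto simp: ring_idempotent_def)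
  define d where "d = \<one> \<ominus> e"
  have [simp]: "d \<in> carrier R" by (simp add: d_def)
  have de: "d \<otimes> e = \<zero>" and ed: "e \<otimes> d = \<zero>"
    by (simp_all add: d_def a_minus_def l_distr r_distr l_minus r_minus ee r_neg)
  have "d \<otimes> (e \<otimes> x) = \<zero>" "e \<otimes> (d \<otimes> x) = \<zero>" if "x \<in> carrier R" for x
    using that by (simp_all add: m_assoc[symmetric] de ed)
  then have "(e \<otimes> r \<otimes> d) \<otimes> (e \<otimes> r \<otimes> d) = \<zero>" "(d \<otimes> r \<otimes> e) \<otimes> (d \<otimes> r \<otimes> e) = \<zero>"
    by (simp_all add: m_assoc)
  then have "e \<otimes> r \<otimes> d = \<zero>" "d \<otimes> r \<otimes> e = \<zero>"
    by (auto intro: reduced_ringD[OF reduced])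
  moreover have "e \<otimes> r \<otimes> d = e \<otimes> r \<ominus> e \<otimes> r \<otimes> e"
    by (simp add: d_def a_minus_def r_distr r_minus m_assoc)
  moreover have "d \<otimes> r \<otimes> e = r \<otimes> e \<ominus> e \<otimes> r \<otimes> e"
    by (simp add: d_def a_minus_def l_distr l_minus m_assoc)
  ultimately have "e \<otimes> r = e \<otimes> r \<otimes> e" "r \<otimes> e = e \<otimes> r \<otimes> e"
    by (metis r_right_minus_eq m_closed \<open>e \<in> carrier R\<close> r)+
  then show ?thesis by (rule trans[OF _ sym])
qed

end

section \<open>Semiprimitive rings\<close>

text \<open>
  Here \<open>r w = e + u\<close> is clean, and \<open>e = 1\<close> would make \<open>1 - r w = - u\<close> a unit.
\<close>

lemma (in ring) cubic_nil_semiprimitive_reduced: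
  assumes cubic: "cubic_nil R" and semiprimitive: "jacobson_radical R \<subseteq> {\<zero>}"
  shows "reduced_ring R"
proof (rule semiprimitive_reduced[OF semiprimitive])
  show "\<not> fibonacci_pair R a g" for a g
    using fibonacci_pair_not_cubic_nil cubic by blast
next
  fix w r assume [simp]: "w \<in> carrier R" "r \<in> carrier R" and nonunit: "\<one> \<ominus> r \<otimes> w \<notin> Units R"
  obtain e u where e: "ring_idempotent R e" and u: "u \<in> Units R" and rw: "r \<otimes> w = e \<oplus> u"
    using cubic_nil_imp_clean[OF cubic, of "r \<otimes> w"] by auto
  have [simp]: "e \<in> carrier R" "u \<in> carrier R" using e u by (auto simp: ring_idempotent_def)
  have "e \<noteq> \<one>"
  proof
    assume "e = \<one>"
    then have "\<one> \<ominus> r \<otimes> w = \<ominus> u"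
      by (simp add: rw a_minus_def minus_add r_neg2)
    moreover have "\<ominus> u \<in> Units R"
      using Units_m_closed[OF Units_minus_one_closed u] by (simp add: l_minus)
    ultimately show False using nonunit by simp
  qed
  then show "\<exists>s \<in> carrier R. ring_idempotent R (s \<otimes> (r \<otimes> w)) \<and> s \<otimes> (r \<otimes> w) \<noteq> \<zero>"
    using idempotent_in_left_ideal_of_feebly_clean[of e \<zero> u "r \<otimes> w"] e u rw
    by (auto simp: orthogonal_idempotents_def ring_idempotent_def a_minus_def)
qed

context commutative_model
begin

lemma model_null_of_int_iff: "model_null (of_int i) \<longleftrightarrow> \<guillemotleft>i\<guillemotright> = \<zero>"
  by (simp add: model_null_def model_of_int)

text \<open>
  If \<open>3 = e - f + u\<close> with \<open>u\<^sup>2 = 1\<close>, then \<open>(3 - e + f)\<^sup>2 - 1\<close> equals \<open>3\<close> on the part of \<open>e\<close>, \<open>15\<close>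
  on that of \<open>f\<close> and \<open>8\<close> on that of \<open>1 - e - f\<close>. So \<open>120\<close>, the least common multiple, is zero.
\<close>

lemma model_120_null:
  assumes "model_null (e ^ 2 - e)" "model_null (f ^ 2 - f)" "model_null (e * f)"
    and "model_null ((3 - e + f) ^ 2 - 1)"
  shows "model_null 120"
proof -
  define h where "h = 8 - 5 * e + 7 * f"
  have "h = ((3 - e + f) ^ 2 - 1) - (e ^ 2 - e) - (f ^ 2 - f) + 2 * (e * f)"
    by (simp add: h_def algebra_simps eval_nat_numeral)
  then have h: "model_null h"
    using assms by (simp only: model_null_add model_null_diff model_null_mult2)
  have "3 * e = e * h + 5 * (e ^ 2 - e) - 7 * (e * f)"
    by (simp add: h_def algebra_simps eval_nat_numeral)
  then have e: "model_null (3 * e)"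
    using assms h by (simp only: model_null_add model_null_diff model_null_mult2)
  have "15 * f = f * h + 5 * (e * f) - 7 * (f ^ 2 - f)"
    by (simp add: h_def algebra_simps eval_nat_numeral)
  then have f: "model_null (15 * f)"
    using assms h by (simp only: model_null_add model_null_diff model_null_mult2)
  have "120 = 15 * h + 25 * (3 * e) - 7 * (15 * f)"
    by (simp add: h_def algebra_simps)
  then show ?thesis
    using e f h by (metis model_null_add model_null_diff model_null_mult2)
qed

text \<open>
  Modulo the relations, \<open>a\<^sup>3 - a = 3 y\<close> with \<open>y = e - f + (e + f) u\<close>, and \<open>y\<^sup>2\<close> is a multiple of
  \<open>2\<close>, so that \<open>(3 y)\<^sup>2\<close> is a multiple of \<open>18\<close>. The auxiliary \<open>b\<close> is the reduced form of \<open>a\<^sup>2\<close>, and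
  \<open>2 t\<close> that of \<open>y\<^sup>2\<close>.
\<close>

lemma model_feebly_clean_cube:
  assumes "model_null (e ^ 2 - e)" "model_null (f ^ 2 - f)" "model_null (e * f)"
    and "model_null (u ^ 2 - 1)" "model_null 6"
  shows "model_null (((e - f + u) ^ 3 - (e - f + u)) ^ 2)"
proof -
  define a where "a = e - f + u"
  define b where "b = e + f + 1 + 2 * (e * u) - 2 * (f * u)"
  define t where "t = e + f + e * u - f * u"
  define y where "y = e - f + e * u + f * u"
  define z where "z = a ^ 3 - a"
  have "a ^ 2 - b = (e ^ 2 - e) + (f ^ 2 - f) + (u ^ 2 - 1) - 2 * (e * f)"
    by (simp add: a_def b_def algebra_simps eval_nat_numeral)
  then have ab: "model_null (a ^ 2 - b)"
    using assms by (simp only: model_null_add model_null_diff model_null_mult2)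
  have "a * b - a - 3 * y = (1 + 2 * u) * (e ^ 2 - e) + (2 * u - 1) * (f ^ 2 - f) -
      4 * u * (e * f) + 2 * (e - f) * (u ^ 2 - 1)"
    by (simp add: a_def b_def y_def algebra_simps eval_nat_numeral)
  then have "model_null (a * b - a - 3 * y)"
    using assms by (simp only: model_null_add model_null_diff model_null_mult2)
  moreover have "z - 3 * y = a * (a ^ 2 - b) + (a * b - a - 3 * y)"
    by (simp add: z_def algebra_simps eval_nat_numeral)
  ultimately have zy: "model_null (z - 3 * y)"
    using ab by (simp only: model_null_add model_null_mult2)
  have "y ^ 2 - 2 * t = (1 + u ^ 2 + 2 * u) * (e ^ 2 - e) + (1 + u ^ 2 - 2 * u) * (f ^ 2 - f) +
      (e + f) * (u ^ 2 - 1) + (2 * u ^ 2 - 2) * (e * f)"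
    by (simp add: y_def t_def algebra_simps eval_nat_numeral)
  then have yt: "model_null (y ^ 2 - 2 * t)"
    using assms by (simp only: model_null_add model_null_diff model_null_mult2)
  have "z ^ 2 = (z + 3 * y) * (z - 3 * y) + 9 * (y ^ 2 - 2 * t) + (3 * t) * 6"
    by (simp add: algebra_simps eval_nat_numeral)
  then have "model_null (z ^ 2)"
    using zy yt assms by (simp only: model_null_add model_null_mult2)
  then show ?thesis by (simp only: z_def a_def)
qed

end

text \<open>
  Since \<open>120 = 0\<close>, the integer \<open>7\<close> is a unit (\<open>7 \<cdot> 103 = 721\<close>), so \<open>48 = 7\<^sup>2 - 1\<close> is zero and with it
  \<open>24 = gcd 48 120\<close>. Then \<open>6\<^sup>3 = 9 \<cdot> 24\<close> vanishes, and a central nilpotent element lies in the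
  Jacobson radical.
\<close>

lemma (in ring) exponent_2_six_zero:
  assumes feebly: "feebly_clean R" and exponent: "units_exponent_le_2 R"
    and semiprimitive: "jacobson_radical R \<subseteq> {\<zero>}"
  shows "\<guillemotleft>6\<guillemotright> = \<zero>"
proof -
  have square: "v [^] (2::nat) = \<one>" if "v \<in> Units R" for v
    using exponent that by (simp add: units_exponent_le_2_def)
  obtain e f u where ef: "orthogonal_idempotents R e f" and u: "u \<in> Units R"
      and eq: "\<guillemotleft>3\<guillemotright> = (e \<ominus> f) \<oplus> u"
    using feebly of_int_closed[of 3] unfolding feebly_clean_def by blast
  have [simp]: "e \<in> carrier R" "f \<in> carrier R" "u \<in> carrier R"
    using ef u by (auto simp: orthogonal_idempotents_def ring_idempotent_def)
  obtain \<phi> :: "int poly poly poly \<Rightarrow> 'a" and p q where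
      \<phi>: "commutative_model R \<phi>" and p: "\<phi> p = e" and q: "\<phi> q = f"
    using obtain_model2[of e f] ef by (auto simp: orthogonal_idempotents_def)
  interpret commutative_model R \<phi> by (rule \<phi>)
  have cancel: "(d \<oplus> u) \<ominus> d = u" if "d \<in> carrier R" for d
    using that by (simp add: a_minus_def a_comm[of d u] a_assoc r_neg)
  have "\<phi> (3 - (p - q)) = \<guillemotleft>3\<guillemotright> \<ominus> (e \<ominus> f)"
    using model_of_int[of 3] by (simp only: model_diff p q) simp
  also have "\<dots> = u" unfolding eq by (rule cancel) simp
  also have "3 - (p - q) = 3 - p + q" by simp
  finally have "\<phi> ((3 - p + q) ^ 2) = \<phi> 1"
    using square[OF u] by (simp add: model_power)
  then have "model_null ((3 - p + q) ^ 2 - 1)" by (simp only: model_null_diff_iff)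
  moreover have "model_null (p ^ 2 - p)" "model_null (q ^ 2 - q)"
    using ef idempotent_iff_null[of p] idempotent_iff_null[of q]
    by (simp_all add: p q orthogonal_idempotents_def)
  moreover have "model_null (p * q)"
    using ef by (simp add: orthogonal_idempotents_def model_null_def model_mult p q)
  ultimately have n120: "model_null 120" by (intro model_120_null)
  have "model_null (7 * 103 - 1)"
    using model_null_mult1[OF n120, of 6] by simp
  then have "\<phi> 7 \<in> Units R"
    by (intro model_unit_if_mult_one[of 7 103]) (simp only: model_null_diff_iff model_one)
  then have "\<phi> (7 ^ 2) = \<phi> 1"
    by (simp only: model_power square model_one)
  then have n48: "model_null (7 ^ 2 - 1)" by (simp only: model_null_diff_iff)
  have "model_null (120 - 2 * (7 ^ 2 - 1))"
    by (rule model_null_diff[OF n120 model_null_mult2[OF n48]])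
  then have "model_null (of_int 24)" by simp
  then have 24: "\<guillemotleft>24\<guillemotright> = \<zero>" by (simp only: model_null_of_int_iff)
  have "\<guillemotleft>6\<guillemotright> \<in> jacobson_radical R"
    unfolding jacobson_radical_iff
  proof (intro conjI ballI of_int_closed)
    fix r assume r: "r \<in> carrier R"
    obtain \<psi> :: "int poly poly poly \<Rightarrow> 'a" and p where
        \<psi>: "commutative_model R \<psi>" and p: "\<psi> p = r"
      using obtain_model1[OF r] .
    interpret n: commutative_model R \<psi> by (rule \<psi>)
    have "n.model_null (of_int 24)" using 24 by (simp only: n.model_null_of_int_iff)
    then have "n.model_null (9 * p ^ 3 * of_int 24)" by (rule n.model_null_mult2)
    moreover have "(1 - p * 6) * (1 + 6 * p + 36 * p ^ 2) = 1 - 9 * p ^ 3 * of_int 24"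
      by (simp add: algebra_simps eval_nat_numeral)
    ultimately have "\<psi> ((1 - p * 6) * (1 + 6 * p + 36 * p ^ 2)) = \<one>"
      by (simp add: n.model_diff n.model_null_def a_minus_def)
    then have "\<psi> (1 - p * 6) \<in> Units R" by (rule n.model_unit_if_mult_one)
    moreover have "\<psi> (1 - p * 6) = \<one> \<ominus> r \<otimes> \<guillemotleft>6\<guillemotright>"
      using n.model_of_int[of 6] by (simp add: n.model_diff n.model_mult p)
    ultimately show "\<exists>s \<in> carrier R. s \<otimes> (\<one> \<ominus> r \<otimes> \<guillemotleft>6\<guillemotright>) = \<one>"
      using Units_l_inv_ex by simp
  qed
  then show ?thesis using semiprimitive by blast
qed

text \<open>
  In \<open>r w = e - f + u\<close> the only obstacle to a nonzero idempotent in \<open>R r w\<close> is \<open>e + f = 1\<close>. As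
  \<open>2 w = 0\<close>, the element \<open>b = r w\<close> equals \<open>3 b\<close>, and \<open>6 = 0\<close> turns \<open>3 (e - f) = 3 (2 e - 1)\<close> into
  \<open>-3\<close>. Thus \<open>b = 3 u - 3\<close>, and \<open>1 - b = 4 - 3 u\<close> has square \<open>25 - 24 u = 1\<close>.
\<close>

lemma (in ring) exponent_2_semiprimitive_reduced:
  assumes feebly: "feebly_clean R" and exponent: "units_exponent_le_2 R"
    and semiprimitive: "jacobson_radical R \<subseteq> {\<zero>}"
  shows "reduced_ring R"
proof (rule semiprimitive_reduced[OF semiprimitive])
  show "\<not> fibonacci_pair R a g" for a g
    using fibonacci_pair_not_exponent_2 exponent by blast
next
  have square: "v [^] (2::nat) = \<one>" if "v \<in> Units R" for v
    using exponent that by (simp add: units_exponent_le_2_def)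
  have six: "\<guillemotleft>6\<guillemotright> = \<zero>" by (rule exponent_2_six_zero[OF assms])
  fix w r assume [simp]: "w \<in> carrier R" "r \<in> carrier R" and ww: "w \<otimes> w = \<zero>"
    and nonunit: "\<one> \<ominus> r \<otimes> w \<notin> Units R"
  \<comment> \<open>\<open>1 + w\<close> is a unit with inverse \<open>1 - w\<close>, so its square \<open>1 + 2 w\<close> is \<open>1\<close>.\<close>
  have 2: "\<guillemotleft>2\<guillemotright> \<otimes> w = \<zero>"
  proof -
    obtain \<phi> :: "int poly poly poly \<Rightarrow> 'a" and p where
        \<phi>: "commutative_model R \<phi>" and p: "\<phi> p = w"
      using obtain_model1[of w] by auto
    interpret commutative_model R \<phi> by (rule \<phi>)
    have pp: "model_null (p ^ 2)"
      by (simp add: model_null_def model_mult monoid_mult_class.power2_eq_square p ww)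
    have "(1 + p) * (1 - p) = 1 - p ^ 2"
      by (simp add: algebra_simps eval_nat_numeral)
    then have "\<phi> ((1 + p) * (1 - p)) = \<one>"
      using pp by (simp add: model_diff model_null_def a_minus_def)
    then have "\<phi> (1 + p) \<in> Units R" by (rule model_unit_if_mult_one)
    then have "\<phi> ((1 + p) ^ 2) = \<phi> 1" by (simp only: model_power square model_one)
    then have "model_null ((1 + p) ^ 2 - 1)" by (simp only: model_null_diff_iff)
    moreover have "2 * p = ((1 + p) ^ 2 - 1) - p ^ 2"
      by (simp add: algebra_simps eval_nat_numeral)
    ultimately have "model_null (2 * p)"
      using pp by (simp only: model_null_diff)
    then show ?thesis
      using model_of_int[of 2] by (simp add: model_null_def model_mult p)
  qed
  define b where "b = r \<otimes> w"
  have [simp]: "b \<in> carrier R" by (simp add: b_def)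
  have "\<guillemotleft>2\<guillemotright> \<otimes> b = r \<otimes> (\<guillemotleft>2\<guillemotright> \<otimes> w)"
    unfolding b_def using int_scalar_commute[of r 2] by (simp add: m_assoc[symmetric])
  then have b2: "\<guillemotleft>2\<guillemotright> \<otimes> b = \<zero>" by (simp add: 2)
  have "\<guillemotleft>2 + 1\<guillemotright> \<otimes> b = \<guillemotleft>2\<guillemotright> \<otimes> b \<oplus> \<guillemotleft>1\<guillemotright> \<otimes> b"
    by (simp only: of_int_add l_distr of_int_closed \<open>b \<in> carrier R\<close>)
  then have b3: "\<guillemotleft>3\<guillemotright> \<otimes> b = b" by (simp add: b2)
  obtain e f u where ef: "orthogonal_idempotents R e f" and u: "u \<in> Units R"
      and b: "b = (e \<ominus> f) \<oplus> u"
    using feebly \<open>b \<in> carrier R\<close> unfolding feebly_clean_def by blast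
  have [simp]: "e \<in> carrier R" "f \<in> carrier R" "u \<in> carrier R"
    using ef u by (auto simp: orthogonal_idempotents_def ring_idempotent_def)
  have "e \<oplus> f \<noteq> \<one>"
  proof
    assume sum: "e \<oplus> f = \<one>"
    have "\<guillemotleft>3\<guillemotright> \<otimes> (e \<ominus> f) = \<ominus> \<guillemotleft>3\<guillemotright>"
    proof -
      obtain \<phi> :: "int poly poly poly \<Rightarrow> 'a" and p q where
          \<phi>: "commutative_model R \<phi>" and p: "\<phi> p = e" and q: "\<phi> q = f"
        using obtain_model2[of e f] ef by (auto simp: orthogonal_idempotents_def)
      interpret commutative_model R \<phi> by (rule \<phi>)
      have "model_null (p + q - 1)"
        by (simp add: model_null_diff_iff model_add p q sum)
      moreover have "model_null 6" using model_null_of_int_iff[of 6] six by simp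
      ultimately have "model_null (6 * p - 3 * (p + q - 1))"
        by (simp only: model_null_diff model_null_mult1 model_null_mult2)
      then have "model_null (3 * (p - q) - (- 3))" by (simp add: algebra_simps)
      then have "\<phi> (3 * (p - q)) = \<phi> (- 3)" by (simp only: model_null_diff_iff)
      then show ?thesis
        using model_of_int[of 3] by (simp add: model_mult model_diff model_uminus p q a_minus_def r_distr r_minus)
    qed
    then have b_eq: "b = \<guillemotleft>3\<guillemotright> \<otimes> u \<ominus> \<guillemotleft>3\<guillemotright>"
      using b3 unfolding b by (simp add: r_distr a_minus_def a_comm)
    obtain \<phi> :: "int poly poly poly \<Rightarrow> 'a" and p where
        \<phi>: "commutative_model R \<phi>" and p: "\<phi> p = u"
      using obtain_model1[of u] by auto
    interpret commutative_model R \<phi> by (rule \<phi>)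
    have "model_null 6" using model_null_of_int_iff[of 6] six by simp
    moreover have "model_null (p ^ 2 - 1)"
      by (simp add: model_null_diff_iff model_power p square u)
    moreover have "(1 - (3 * p - 3)) ^ 2 - 1 = (4 - 4 * p) * 6 + 9 * (p ^ 2 - 1)"
      by (simp add: algebra_simps eval_nat_numeral)
    ultimately have "model_null ((1 - (3 * p - 3)) ^ 2 - 1)"
      by (simp only: model_null_add model_null_mult2)
    then have "\<phi> (1 - (3 * p - 3)) \<in> Units R"
      by (intro model_unit_if_square_one_mod_nil model_nil_null)
    moreover have "\<phi> (1 - (3 * p - 3)) = \<one> \<ominus> b"
      using model_of_int[of 3] by (simp only: model_diff model_mult model_one p b_eq) simp
    ultimately show False using nonunit by (simp add: b_def)
  qed
  then show "\<exists>s \<in> carrier R. ring_idempotent R (s \<otimes> (r \<otimes> w)) \<and> s \<otimes> (r \<otimes> w) \<noteq> \<zero>"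
    using idempotent_in_left_ideal_of_feebly_clean[OF ef u b] unfolding b_def by blast
qed

lemma (in ring) exponent_2_semiprimitive_cube:
  assumes feebly: "feebly_clean R" and exponent: "units_exponent_le_2 R"
    and semiprimitive: "jacobson_radical R \<subseteq> {\<zero>}" and a: "a \<in> carrier R"
  shows "a [^] (3::nat) \<ominus> a = \<zero>"
proof -
  have reduced: "reduced_ring R" by (rule exponent_2_semiprimitive_reduced[OF assms(1-3)])
  obtain e f u where ef: "orthogonal_idempotents R e f" and u: "u \<in> Units R"
      and eq: "a = (e \<ominus> f) \<oplus> u"
    using feebly a unfolding feebly_clean_def by blast
  have idem: "ring_idempotent R e" "ring_idempotent R f" "e \<otimes> f = \<zero>" "f \<otimes> e = \<zero>"
    using ef by (auto simp: orthogonal_idempotents_def)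
  then have [simp]: "e \<in> carrier R" "f \<in> carrier R" "u \<in> carrier R"
    using u by (auto simp: ring_idempotent_def)
  have comm: "e \<otimes> u = u \<otimes> e" "f \<otimes> u = u \<otimes> f"
    by (simp_all add: reduced_idempotent_central[OF reduced, of _ u] idem)
  have "e \<otimes> f = f \<otimes> e" using idem by simp
  then obtain \<phi> :: "int poly poly poly \<Rightarrow> 'a" and p q r where
      \<phi>: "commutative_model R \<phi>" and p: "\<phi> p = e" and q: "\<phi> q = f" and r: "\<phi> r = u"
    by (rule obtain_model3[of e f u, rotated 3]) (use comm in simp_all)
  interpret commutative_model R \<phi> by (rule \<phi>)
  have "model_null 6"
    using model_null_of_int_iff[of 6] exponent_2_six_zero[OF assms(1-3)] by simp
  moreover have "model_null (p ^ 2 - p)" "model_null (q ^ 2 - q)"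
    using idem idempotent_iff_null[of p] idempotent_iff_null[of q] by (simp_all add: p q)
  moreover have "model_null (p * q)"
    using idem by (simp add: model_null_def model_mult p q)
  moreover have "model_null (r ^ 2 - 1)"
    using exponent u by (simp add: model_null_diff_iff model_power r units_exponent_le_2_def)
  ultimately have "model_null (((p - q + r) ^ 3 - (p - q + r)) ^ 2)"
    by (intro model_feebly_clean_cube)
  then have "model_nil ((p - q + r) ^ 3 - (p - q + r))"
    by (intro model_nil_power_cancel[OF model_nil_null])
  then have "\<phi> ((p - q + r) ^ 3 - (p - q + r)) = \<zero>"
    by (intro reduced_nilpotent_zero[OF reduced]) (simp only: model_nil_iff_nilpotent)
  then show ?thesis by (simp add: model_diff model_power model_add p q r eq)
qed

section \<open>The quotient by the Jacobson radical\<close>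

context ring
begin

abbreviation "J \<equiv> jacobson_radical R"
abbreviation "Q \<equiv> R Quot J"
abbreviation "\<pi> x \<equiv> J +> x"

lemma radical_quotient_hom: "ring_hom_ring R Q (\<lambda>x. \<pi> x)"
  using ideal.rcos_ring_hom_ring[OF jacobson_radical_ideal] by simp

lemma radical_quotient_obtain:
  assumes "y \<in> carrier Q"
  obtains x where "x \<in> carrier R" "y = \<pi> x"
  using assms by (auto simp: FactRing_def A_RCOSETS_def')

lemma radical_quotient_zero_iff:
  assumes "x \<in> carrier R"
  shows "\<pi> x = \<zero>\<^bsub>Q\<^esub> \<longleftrightarrow> x \<in> J"
proof -
  interpret J: ideal J R by (rule jacobson_radical_ideal)
  show ?thesis
    using J.a_rcos_const[of x] J.a_rcos_self[OF assms] by (auto simp: FactRing_def)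
qed

text \<open>
  A left inverse of \<open>1 - r x\<close> modulo \<open>J\<close> is one up to an element of \<open>1 + J\<close>, which consists of units.
\<close>

lemma radical_quotient_semiprimitive: "jacobson_radical Q \<subseteq> {\<zero>\<^bsub>Q\<^esub>}"
proof
  interpret h: ring_hom_ring R Q "\<lambda>x. \<pi> x" by (rule radical_quotient_hom)
  fix y assume y: "y \<in> jacobson_radical Q"
  then have "y \<in> carrier Q" by (simp add: h.S.jacobson_radical_iff)
  then obtain x where x [simp]: "x \<in> carrier R" and yx: "y = \<pi> x"
    by (rule radical_quotient_obtain)
  have "\<exists>s \<in> carrier R. s \<otimes> (\<one> \<ominus> r \<otimes> x) = \<one>" if r [simp]: "r \<in> carrier R" for r
  proof -
    have "\<exists>z \<in> carrier Q. z \<otimes>\<^bsub>Q\<^esub> (\<one>\<^bsub>Q\<^esub> \<ominus>\<^bsub>Q\<^esub> \<pi> r \<otimes>\<^bsub>Q\<^esub> y) = \<one>\<^bsub>Q\<^esub>"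
      using y h.hom_closed[OF r] h.S.jacobson_radical_iff by blast
    then obtain s where s [simp]: "s \<in> carrier R"
        and eq: "\<pi> s \<otimes>\<^bsub>Q\<^esub> (\<one>\<^bsub>Q\<^esub> \<ominus>\<^bsub>Q\<^esub> \<pi> r \<otimes>\<^bsub>Q\<^esub> y) = \<one>\<^bsub>Q\<^esub>"
      using radical_quotient_obtain by metis
    define c where "c = s \<otimes> (\<one> \<ominus> r \<otimes> x)"
    have [simp]: "c \<in> carrier R" by (simp add: c_def)
    have "\<pi> c = \<one>\<^bsub>Q\<^esub>"
      using eq unfolding yx c_def by (simp add: h.hom_mult h.hom_add h.hom_a_inv a_minus_def)
    then have "\<pi> (\<one> \<ominus> c) = \<zero>\<^bsub>Q\<^esub>"
      by (simp add: a_minus_def h.S.r_neg)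
    then have "\<one> \<ominus> c \<in> J" by (simp add: radical_quotient_zero_iff)
    then have "\<one> \<ominus> \<one> \<otimes> (\<one> \<ominus> c) \<in> Units R" by (rule jacobson_radical_unit) simp
    moreover have "\<one> \<ominus> \<one> \<otimes> (\<one> \<ominus> c) = c"
      by (simp add: a_minus_def minus_add r_neg2)
    ultimately obtain d where "d \<in> carrier R" "d \<otimes> c = \<one>"
      using Units_l_inv_ex by auto
    then show ?thesis
      unfolding c_def by (intro bexI[of _ "d \<otimes> s"]) (simp_all add: m_assoc)
  qed
  then have "x \<in> J" by (simp add: jacobson_radical_iff)
  then show "y \<in> {\<zero>\<^bsub>Q\<^esub>}" by (simp add: yx radical_quotient_zero_iff)
qed

lemma radical_quotient_cube:
  assumes "x \<in> carrier R"
  shows "\<pi> x [^]\<^bsub>Q\<^esub> (3::nat) \<ominus>\<^bsub>Q\<^esub> \<pi> x = \<pi> (x [^] (3::nat) \<ominus> x)"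
proof -
  interpret h: ring_hom_ring R Q "\<lambda>x. \<pi> x" by (rule radical_quotient_hom)
  show ?thesis using assms by (simp add: a_minus_def h.hom_nat_pow)
qed

lemma radical_quotient_cubic_nil:
  assumes cubic: "cubic_nil R"
  shows "cubic_nil Q"
  unfolding cubic_nil_def
proof
  interpret h: ring_hom_ring R Q "\<lambda>x. \<pi> x" by (rule radical_quotient_hom)
  fix y assume "y \<in> carrier Q"
  then obtain x where x [simp]: "x \<in> carrier R" and y: "y = \<pi> x"
    by (rule radical_quotient_obtain)
  obtain n :: nat where n: "n > 0" and pow: "(x [^] (3::nat) \<ominus> x) [^] n = \<zero>"
    using cubic x unfolding cubic_nil_def ring_nilpotent_def by blast
  have "\<pi> (x [^] (3::nat) \<ominus> x) [^]\<^bsub>Q\<^esub> n = \<pi> ((x [^] (3::nat) \<ominus> x) [^] n)"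
    by (simp add: h.hom_nat_pow)
  also have "\<dots> = \<zero>\<^bsub>Q\<^esub>" by (simp only: pow h.hom_zero)
  finally have "(y [^]\<^bsub>Q\<^esub> (3::nat) \<ominus>\<^bsub>Q\<^esub> y) [^]\<^bsub>Q\<^esub> n = \<zero>\<^bsub>Q\<^esub>"
    by (simp only: y radical_quotient_cube x)
  then show "ring_nilpotent Q (y [^]\<^bsub>Q\<^esub> (3::nat) \<ominus>\<^bsub>Q\<^esub> y)"
    using n unfolding ring_nilpotent_def by (auto simp: y)
qed

lemma radical_quotient_feebly_clean:
  assumes feebly: "feebly_clean R"
  shows "feebly_clean Q"
  unfolding feebly_clean_def
proof
  interpret h: ring_hom_ring R Q "\<lambda>x. \<pi> x" by (rule radical_quotient_hom)
  fix y assume "y \<in> carrier Q"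
  then obtain x where x: "x \<in> carrier R" and y: "y = \<pi> x"
    by (rule radical_quotient_obtain)
  obtain e f u where ef: "orthogonal_idempotents R e f" and u: "u \<in> Units R"
      and eq: "x = (e \<ominus> f) \<oplus> u"
    using feebly x unfolding feebly_clean_def by blast
  have mem [simp]: "e \<in> carrier R" "f \<in> carrier R" "u \<in> carrier R" "inv u \<in> carrier R"
    using ef u by (auto simp: orthogonal_idempotents_def ring_idempotent_def)
  have "orthogonal_idempotents Q (\<pi> e) (\<pi> f)"
    using ef unfolding orthogonal_idempotents_def ring_idempotent_def
    by (simp add: h.hom_mult[symmetric])
  moreover have "\<pi> u \<in> Units Q"
  proof -
    have "\<pi> u \<otimes>\<^bsub>Q\<^esub> \<pi> (inv u) = \<one>\<^bsub>Q\<^esub>" "\<pi> (inv u) \<otimes>\<^bsub>Q\<^esub> \<pi> u = \<one>\<^bsub>Q\<^esub>"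
      using u by (simp_all add: h.hom_mult[symmetric] del: h.hom_mult)
    then show ?thesis unfolding Units_def using h.hom_closed mem by blast
  qed
  moreover have "y = (\<pi> e \<ominus>\<^bsub>Q\<^esub> \<pi> f) \<oplus>\<^bsub>Q\<^esub> \<pi> u"
    by (simp add: y eq a_minus_def)
  ultimately show "\<exists>e f. \<exists>u \<in> Units Q. orthogonal_idempotents Q e f \<and> y = (e \<ominus>\<^bsub>Q\<^esub> f) \<oplus>\<^bsub>Q\<^esub> u"
    by blast
qed

text \<open>
  In \<open>x (1 - x\<^sup>2)\<close>, which is nilpotent, the second factor is a unit commuting with \<open>x\<close>.
\<close>

lemma cubic_nil_imp_radical_nil:
  assumes cubic: "cubic_nil R"
  shows "nil_subset R J"
  unfolding nil_subset_def
proof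
  fix x assume x: "x \<in> J"
  then have xR: "x \<in> carrier R" by (simp add: jacobson_radical_iff)
  then obtain \<phi> :: "int poly poly poly \<Rightarrow> 'a" and p where
      \<phi>: "commutative_model R \<phi>" and p: "\<phi> p = x"
    using obtain_model1 by metis
  interpret commutative_model R \<phi> by (rule \<phi>)
  have unit: "\<phi> (1 - p ^ 2) \<in> Units R"
    using jacobson_radical_unit[OF x xR]
    by (simp add: model_diff model_mult monoid_mult_class.power2_eq_square p)
  have "model_nil (- (p ^ 3 - p))" by (intro model_nil_uminus cubic_nil_model[OF cubic])
  then have "model_nil (p * (1 - p ^ 2))" by (simp add: algebra_simps eval_nat_numeral)
  then obtain n where "model_null (p ^ n * (1 - p ^ 2) ^ n)"
    by (auto simp: model_nil_def power_mult_distrib)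
  then have "\<phi> (p ^ n) \<otimes> \<phi> (1 - p ^ 2) [^] n = \<zero>"
    by (simp add: model_null_def model_mult model_power)
  moreover have v: "\<phi> (1 - p ^ 2) [^] n \<in> Units R" using unit by (rule Units_pow_closed)
  have "\<phi> (p ^ n) = \<phi> (p ^ n) \<otimes> \<phi> (1 - p ^ 2) [^] n \<otimes> inv (\<phi> (1 - p ^ 2) [^] n)"
    using v by (simp add: m_assoc)
  ultimately have "\<phi> (p ^ n) = \<zero>" using v by simp
  then have "model_nil p" unfolding model_nil_def model_null_def by blast
  then show "ring_nilpotent R x" by (simp add: model_nil_iff_nilpotent p)
qed

lemma cubic_nil_imp_quotient_exponent_2:
  assumes cubic: "cubic_nil R"
  shows "units_exponent_le_2 Q"
  unfolding units_exponent_le_2_def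
proof
  interpret h: ring_hom_ring R Q "\<lambda>x. \<pi> x" by (rule radical_quotient_hom)
  fix v assume v: "v \<in> Units Q"
  have [simp]: "v \<in> carrier Q" using v by (rule h.S.Units_closed)
  have cubicQ: "cubic_nil Q" by (rule radical_quotient_cubic_nil[OF cubic])
  then have "ring_nilpotent Q (v [^]\<^bsub>Q\<^esub> (3::nat) \<ominus>\<^bsub>Q\<^esub> v)" by (simp add: cubic_nil_def)
  then have "v [^]\<^bsub>Q\<^esub> (3::nat) \<ominus>\<^bsub>Q\<^esub> v = \<zero>\<^bsub>Q\<^esub>"
    using h.S.cubic_nil_semiprimitive_reduced[OF cubicQ radical_quotient_semiprimitive]
    by (intro h.S.reduced_nilpotent_zero)
  then have "v [^]\<^bsub>Q\<^esub> (3::nat) = v"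
    by (simp add: h.S.r_right_minus_eq)
  then have "v \<otimes>\<^bsub>Q\<^esub> v [^]\<^bsub>Q\<^esub> (2::nat) = v \<otimes>\<^bsub>Q\<^esub> \<one>\<^bsub>Q\<^esub>"
    by (simp add: eval_nat_numeral h.S.m_assoc)
  then show "v [^]\<^bsub>Q\<^esub> (2::nat) = \<one>\<^bsub>Q\<^esub>"
    by (subst (asm) h.S.Units_l_cancel[OF v]) simp_all
qed

lemma feebly_clean_imp_cubic_nil:
  assumes feebly: "feebly_clean R" and nil: "nil_subset R J" and exponent: "units_exponent_le_2 Q"
  shows "cubic_nil R"
  unfolding cubic_nil_def
proof
  interpret h: ring_hom_ring R Q "\<lambda>x. \<pi> x" by (rule radical_quotient_hom)
  fix a assume a [simp]: "a \<in> carrier R"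
  have "\<pi> a [^]\<^bsub>Q\<^esub> (3::nat) \<ominus>\<^bsub>Q\<^esub> \<pi> a = \<zero>\<^bsub>Q\<^esub>"
    by (intro h.S.exponent_2_semiprimitive_cube radical_quotient_feebly_clean feebly exponent
        radical_quotient_semiprimitive h.hom_closed a)
  then have "\<pi> (a [^] (3::nat) \<ominus> a) = \<zero>\<^bsub>Q\<^esub>" by (simp only: radical_quotient_cube a)
  then have "a [^] (3::nat) \<ominus> a \<in> J" by (simp add: radical_quotient_zero_iff)
  then show "ring_nilpotent R (a [^] (3::nat) \<ominus> a)" using nil by (simp add: nil_subset_def)
qed

end

theorem theorem2p5:
  fixes R :: "('a, 'b) ring_scheme"
  assumes "ring R"
  shows "strongly_2_nil_clean R \<longleftrightarrow>
           feebly_clean R \<and>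
           nil_subset R (jacobson_radical R) \<and>
           units_exponent_le_2 (R Quot (jacobson_radical R))"
proof -
  interpret ring R by fact
  show ?thesis
    using strongly_2_nil_clean_imp_cubic_nil cubic_nil_imp_strongly_2_nil_clean
      cubic_nil_imp_feebly_clean cubic_nil_imp_radical_nil cubic_nil_imp_quotient_exponent_2
      feebly_clean_imp_cubic_nil
    by blast
qed

end
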